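(* Let $r\ge1$ and $n\ge1$ be integers. The extended affine Hecke algebra $\widehat{\mathcal{H}}_n^{\mathrm{aff}}$ of type $A$ over $R$ is a subalgebra of the affine Yokonuma-Hecke algebra $\widehat{Y}_{r,n}$ over $R$; that is, there is an injective homomorphism of unital $R$-algebras $\widehat{\mathcal{H}}_n^{\mathrm{aff}}\hookrightarrow\widehat{Y}_{r,n}$.
   Context: Let $\zeta=e^{2\pi i/r}$, $\Delta=\prod_{1\le j<i\le r}(\zeta^i-\zeta^j)$, $q$ an indeterminate, and $R=\mathbb{Z}[\frac1r][q,q^{-1},\zeta,\Delta^{-1}]$. Let $s_i=(i,i+1)$ for $1\le i\le n-1$. For an integer $i$, $\overline{i}\in\{0,\dots,n-1\}$ is its residue mod $n$. The extended affine Hecke algebra $\widehat{\mathcal{H}}_n^{\mathrm{aff}}$ of type $A$ is the $R$-algebra generated by $h_{s_0},\dots,h_{s_{n-1}},h_\rho^{\pm1}$ with relations: $h_\rho h_\rho^{-1}=h_\rho^{-1}h_\rho=1$; $h_\rho h_{s_{\overline i}}=h_{s_{\overline{i-1}}}h_\rho$ for $0\le i\le n-1$; $h_{s_i}h_{s_j}=h_{s_j}h_{s_i}$ if $i-j\not\equiv\pm1\pmod n$; $h_{s_{\overline i}}h_{s_{\overline{i+1}}}h_{s_{\overline i}}=h_{s_{\overline{i+1}}}h_{s_{\overline i}}h_{s_{\overline{i+1}}}$ if $0\le i\le n-1$ and $n\ge3$; $h_{s_i}^2=1+(q-q^{-1})h_{s_i}$ for $0\le i\le n-1$. The affine Yokonuma-Hecke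 algebra $\widehat{Y}_{r,n}$ is the $R$-algebra generated by $\bar t_1,\dots,\bar t_n,g_1,\dots,g_{n-1},X_1^{\pm1}$ with relations: $g_ig_j=g_jg_i$ for $|i-j|\ge2$; $g_ig_{i+1}g_i=g_{i+1}g_ig_{i+1}$ for $1\le i\le n-2$; $\bar t_i\bar t_j=\bar t_j\bar t_i$; $g_i\bar t_j=\bar t_{s_i(j)}g_i$ for $1\le i\le n-1$, $1\le j\le n$; $\bar t_i^{\,r}=1$; $g_i^2=1+(q-q^{-1})\bar e_ig_i$ for $1\le i\le n-1$, with $\bar e_i=\frac1r\sum_{s=0}^{r-1}\bar t_i^{\,s}\bar t_{i+1}^{\,-s}$; $X_1X_1^{-1}=X_1^{-1}X_1=1$; $g_1X_1g_1X_1=X_1g_1X_1g_1$; $g_iX_1=X_1g_i$ for $2\le i\le n-1$; $\bar t_jX_1=X_1\bar t_j$ for $1\le j\le n$.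
   Formalization: For n=1 the generator h_{s_0} and its relations are dropped, so the extended affine Hecke algebra is R[h_ρ^{±1}]; with h_{s_0} kept, the claim fails for r=n=1, since (h_{s_0}-q)(h_{s_0}+q^{-1})=0 while the affine Yokonuma-Hecke algebra is the domain R[X_1^{±1}]. *)

theory Defs
  imports
    "HOL-Algebra.Algebraic_Closure_Type"
    "HOL-Algebra.Generated_Rings"
    "HOL-Algebra.QuotRing"
    "HOL-Algebra.Module"
    "HOL-Computational_Algebra.Polynomial_Factorial"
    "HOL-Library.Poly_Mapping"
    "HOL-Number_Theory.Cong"
    "HOL-Combinatorics.Transposition"
begin

section \<open>The ground ring\<close>

text \<open>The ground ring \<open>\<int>[1/r][q, q\<^sup>-\<^sup>1, \<zeta>, \<Delta>\<^sup>-\<^sup>1]\<close> is realised as the subring of the field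
  \<open>\<complex>(q)\<close> of rational functions generated by the displayed elements.\<close>

definition scalar :: "complex \<Rightarrow> complex poly fract" where
  "scalar z = to_fract [:z:]"

definition qvar :: "complex poly fract" where
  "qvar = to_fract [:0, 1:]"

definition zeta :: "nat \<Rightarrow> complex" where
  "zeta r = exp (2 * of_real pi * \<i> / of_nat r)"

definition Delta :: "nat \<Rightarrow> complex" where
  "Delta r = (\<Prod>(i, j) \<in> {(i, j). 1 \<le> j \<and> j < i \<and> i \<le> r}. zeta r ^ i - zeta r ^ j)"

definition ground_ring :: "nat \<Rightarrow> complex poly fract set" where
  "ground_ring r = generate_ring ring_of_type_algebra
     {scalar (1 / of_nat r), qvar, inverse qvar, scalar (zeta r), scalar (1 / Delta r)}"


section \<open>Associative unital algebras given by generators and relations\<close>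

text \<open>Words form the free monoid, written additively because the multiplication of
  \<^typ>\<open>'a \<Rightarrow>\<^sub>0 'b\<close> is convolution along an additive monoid of exponents. So \<^typ>\<open>'g list \<Rightarrow>\<^sub>0 'k\<close>
  with its type class operations is the algebra of noncommutative polynomials.\<close>

instantiation list :: (type) monoid_add
begin

definition zero_list :: "'a list" where
  "0 = []"

definition plus_list :: "'a list \<Rightarrow> 'a list \<Rightarrow> 'a list" where
  "xs + ys = xs @ ys"

instance
  by intro_classes (simp_all add: zero_list_def plus_list_def)

end

definition alg_gen :: "'g \<Rightarrow> 'g list \<Rightarrow>\<^sub>0 'k::comm_ring_1" where
  "alg_gen x = Poly_Mapping.single [x] 1"

definition alg_const :: "'k \<Rightarrow> 'g list \<Rightarrow>\<^sub>0 'k::comm_ring_1" where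
  "alg_const c = Poly_Mapping.single 0 c"

text \<open>The free algebra on the generators \<open>G\<close> over the subring \<open>K\<close> of \<^typ>\<open>'k\<close>.\<close>

definition free_algebra ::
  "'k::comm_ring_1 set \<Rightarrow> 'g set \<Rightarrow> ('k, 'g list \<Rightarrow>\<^sub>0 'k) module" where
  "free_algebra K G =
     \<lparr>carrier = {p. Poly_Mapping.keys p \<subseteq> lists G \<and> (\<forall>w. Poly_Mapping.lookup p w \<in> K)},
      monoid.mult = (*), one = 1, ring.zero = 0, add = (+),
      module.smult = (\<lambda>c p. alg_const c * p)\<rparr>"

text \<open>The library's quotient ring forgets the scalar multiplication; here it is put back,
  in the style of \<^const>\<open>rcoset_mult\<close>.\<close>

definition quotient_algebra :: "('k, 'a) module \<Rightarrow> 'a set \<Rightarrow> ('k, 'a set) module" where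
  "quotient_algebra A I =
     \<lparr>carrier = carrier (A Quot I), monoid.mult = monoid.mult (A Quot I),
      one = monoid.one (A Quot I), ring.zero = ring.zero (A Quot I), add = ring.add (A Quot I),
      module.smult = (\<lambda>c C. \<Union>x\<in>C. I +>\<^bsub>A\<^esub> (c \<odot>\<^bsub>A\<^esub> x))\<rparr>"

text \<open>A relation \<open>a = b\<close> is given by the element \<open>a - b\<close>.\<close>

definition presented_algebra ::
  "'k::comm_ring_1 set \<Rightarrow> 'g set \<Rightarrow> ('g list \<Rightarrow>\<^sub>0 'k) set \<Rightarrow> ('k, ('g list \<Rightarrow>\<^sub>0 'k) set) module"
  where
  "presented_algebra K G rels =
     quotient_algebra (free_algebra K G) (genideal (free_algebra K G) rels)"

text \<open>Homomorphisms of unital \<open>K\<close>-algebras (\<^const>\<open>ring_hom\<close> includes preservation of the unit).\<close>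

definition algebra_hom :: "'k set \<Rightarrow> ('k, 'a) module \<Rightarrow> ('k, 'b) module \<Rightarrow> ('a \<Rightarrow> 'b) set" where
  "algebra_hom K A B =
     {f \<in> ring_hom A B. \<forall>c\<in>K. \<forall>x\<in>carrier A. f (c \<odot>\<^bsub>A\<^esub> x) = c \<odot>\<^bsub>B\<^esub> f x}"


section \<open>The extended affine Hecke algebra of type A\<close>

datatype hecke_gen = HS int | HRho | HRhoInv

abbreviation hs :: "int \<Rightarrow> hecke_gen list \<Rightarrow>\<^sub>0 complex poly fract" where
  "hs i \<equiv> alg_gen (HS i)"

abbreviation hrho :: "hecke_gen list \<Rightarrow>\<^sub>0 complex poly fract" where
  "hrho \<equiv> alg_gen HRho"

abbreviation hrho_inv :: "hecke_gen list \<Rightarrow>\<^sub>0 complex poly fract" where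
  "hrho_inv \<equiv> alg_gen HRhoInv"

text \<open>Indices of the simple reflections \<open>s\<^sub>0, \<dots>, s\<^bsub>n-1\<^esub>\<close> of the affine symmetric group.
  For \<open>n = 1\<close> that group is trivial and there is no simple reflection; the extended
  affine Hecke algebra is then the Laurent polynomial algebra in \<open>h\<^bsub>\<rho>\<^esub>\<close>. (Keeping a generator
  \<open>h\<^bsub>s\<^sub>0\<^esub>\<close> for \<open>n = 1\<close> would give an algebra with zero divisors \<open>h\<^bsub>s\<^sub>0\<^esub> - q\<close> and
  \<open>h\<^bsub>s\<^sub>0\<^esub> + q\<^sup>-\<^sup>1\<close>, which for \<open>r = 1\<close> cannot embed into \<open>\<int>[q\<^sup>\<plusminus>\<^sup>1][X\<^sub>1\<^sup>\<plusminus>\<^sup>1]\<close>.)\<close>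

definition affine_indices :: "nat \<Rightarrow> int set" where
  "affine_indices n = (if n = 1 then {} else {0..int n - 1})"

definition hecke_gens :: "nat \<Rightarrow> hecke_gen set" where
  "hecke_gens n = HS ` affine_indices n \<union> {HRho, HRhoInv}"

definition hecke_rels :: "nat \<Rightarrow> (hecke_gen list \<Rightarrow>\<^sub>0 complex poly fract) set" where
  "hecke_rels n =
     {hrho * hrho_inv - 1, hrho_inv * hrho - 1}
   \<union> {hrho * hs i - hs ((i - 1) mod int n) * hrho | i. i \<in> affine_indices n}
   \<union> {hs i * hs j - hs j * hs i | i j. i \<in> affine_indices n \<and> j \<in> affine_indices n \<and>
        \<not> [i - j = 1] (mod int n) \<and> \<not> [i - j = -1] (mod int n)}
   \<union> {hs i * hs ((i + 1) mod int n) * hs i - hs ((i + 1) mod int n) * hs i * hs ((i + 1) mod int n)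
        | i. i \<in> affine_indices n \<and> n \<ge> 3}
   \<union> {hs i ^ 2 - (1 + alg_const (qvar - inverse qvar) * hs i) | i. i \<in> affine_indices n}"

definition extended_affine_hecke_algebra ::
  "nat \<Rightarrow> nat \<Rightarrow> (complex poly fract, (hecke_gen list \<Rightarrow>\<^sub>0 complex poly fract) set) module"
  where
  "extended_affine_hecke_algebra r n =
     presented_algebra (ground_ring r) (hecke_gens n) (hecke_rels n)"


section \<open>The affine Yokonuma--Hecke algebra\<close>

datatype yokonuma_gen = YT nat | YG nat | YX | YXInv

abbreviation yt :: "nat \<Rightarrow> yokonuma_gen list \<Rightarrow>\<^sub>0 complex poly fract" where
  "yt j \<equiv> alg_gen (YT j)"

abbreviation yg :: "nat \<Rightarrow> yokonuma_gen list \<Rightarrow>\<^sub>0 complex poly fract" where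
  "yg i \<equiv> alg_gen (YG i)"

abbreviation yX :: "yokonuma_gen list \<Rightarrow>\<^sub>0 complex poly fract" where
  "yX \<equiv> alg_gen YX"

abbreviation yX_inv :: "yokonuma_gen list \<Rightarrow>\<^sub>0 complex poly fract" where
  "yX_inv \<equiv> alg_gen YXInv"

text \<open>Since \<open>t\<^sub>j\<^sup>r = 1\<close> is imposed, \<open>t\<^sub>j\<^sup>-\<^sup>s\<close> is represented by \<open>t\<^sub>j\<^bsup>r-s\<^esup>\<close> for \<open>0 \<le> s < r\<close>.\<close>

definition ye :: "nat \<Rightarrow> nat \<Rightarrow> yokonuma_gen list \<Rightarrow>\<^sub>0 complex poly fract" where
  "ye r i = alg_const (scalar (1 / of_nat r)) * (\<Sum>s<r. yt i ^ s * yt (i + 1) ^ (r - s))"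

definition yokonuma_gens :: "nat \<Rightarrow> yokonuma_gen set" where
  "yokonuma_gens n = YT ` {1..n} \<union> YG ` {1..<n} \<union> {YX, YXInv}"

definition yokonuma_rels ::
  "nat \<Rightarrow> nat \<Rightarrow> (yokonuma_gen list \<Rightarrow>\<^sub>0 complex poly fract) set" where
  "yokonuma_rels r n =
     {yg i * yg j - yg j * yg i | i j. i \<in> {1..<n} \<and> j \<in> {1..<n} \<and> \<bar>int i - int j\<bar> \<ge> 2}
   \<union> {yg i * yg (i + 1) * yg i - yg (i + 1) * yg i * yg (i + 1) | i. 1 \<le> i \<and> i + 1 < n}
   \<union> {yt i * yt j - yt j * yt i | i j. i \<in> {1..n} \<and> j \<in> {1..n}}
   \<union> {yg i * yt j - yt (Transposition.transpose i (i + 1) j) * yg i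
        | i j. i \<in> {1..<n} \<and> j \<in> {1..n}}
   \<union> {yt i ^ r - 1 | i. i \<in> {1..n}}
   \<union> {yg i ^ 2 - (1 + alg_const (qvar - inverse qvar) * ye r i * yg i) | i. i \<in> {1..<n}}
   \<union> {yX * yX_inv - 1, yX_inv * yX - 1}
   \<union> (if 1 < n then {yg 1 * yX * yg 1 * yX - yX * yg 1 * yX * yg 1} else {})
   \<union> {yg i * yX - yX * yg i | i. 2 \<le> i \<and> i < n}
   \<union> {yt j * yX - yX * yt j | j. j \<in> {1..n}}"

definition affine_yokonuma_hecke_algebra ::
  "nat \<Rightarrow> nat \<Rightarrow> (complex poly fract, (yokonuma_gen list \<Rightarrow>\<^sub>0 complex poly fract) set) module"
  where
  "affine_yokonuma_hecke_algebra r n =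
     presented_algebra (ground_ring r) (yokonuma_gens n) (yokonuma_rels r n)"

end

theory Submission
  imports Defs
begin

text \<open>Averaging over all \<open>t\<^sub>j\<close> gives a central idempotent \<open>e\<close> of the affine Yokonuma--Hecke
  algebra \<open>Y\<close> with \<open>t\<^sub>j e = e\<close>, so the elements \<open>g\<^sub>i e\<close> and \<open>X\<^sub>1 e\<close> of the corner \<open>eY\<close>
  satisfy the relations of a Bernstein-type presentation of the affine Hecke algebra \<open>H\<close>. There
  \<open>h\<^sub>\<rho> = g\<^bsub>n-1\<^esub> \<cdots> g\<^sub>1 X\<^sub>1\<close> cyclically shifts the generators, which yields a homomorphism
  \<open>\<alpha> : H \<rightarrow> eY\<close>. Adding the one-dimensional representation \<open>h\<^sub>s \<mapsto> q\<close>, \<open>h\<^sub>\<rho> \<mapsto> 1\<close> with values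
  in \<open>(1 - e)Y\<close> makes it unital. Conversely \<open>t\<^sub>j \<mapsto> 1\<close>, \<open>g\<^sub>i \<mapsto> h\<^bsub>s\<^sub>i\<^esub>\<close>,
  \<open>X\<^sub>1 \<mapsto> (h\<^bsub>s\<^bsub>n-1\<^esub>\<^esub> \<cdots> h\<^bsub>s\<^sub>1\<^esub>)\<^sup>-\<^sup>1 h\<^sub>\<rho>\<close> defines a homomorphism \<open>\<psi> : Y \<rightarrow> H\<close> with \<open>\<psi>(e) = 1\<close>, and
  the composite is the identity on generators, whence injectivity.\<close>


section \<open>Braid relations\<close>

text \<open>The retraction \<psi> replaces a basis theorem: linear independence in Y never enters,
  only the fact that \<psi> after \<alpha> fixes the generators. The element e need not be 1, so
  \<alpha> is unital only for the corner; the summand in (1 - e)Y repairs this and is invisible to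
  \<psi> because \<psi>(1 - e) = 0. The value q is admissible there since q^2 = 1 + (q - q^(-1)) q.
  The obstacle is the passage between the two presentations of H. Write V = g_(n-1) ... g_1 and
  h_rho = V X_1. As V alone already carries g_(i+1) to g_i, the shift of s_(i+1) to s_i by h_rho
  says exactly that X_1 commutes with g_(i+1). The two remaining shifts, s_1 to s_0 to s_(n-1),
  combine to h_rho^2 g_1 = g_(n-1) h_rho^2, which is the relation g_1 X_1 g_1 X_1 = X_1 g_1 X_1 g_1
  in disguise. Both translations are equivalences, so one computation serves \<alpha> and \<psi>.
  Every further relation containing s_0 is a conjugate by h_rho of one whose indices are larger by 1
  mod n.\<close>

primrec descending_prod :: "('a, 'b) monoid_scheme \<Rightarrow> (nat \<Rightarrow> 'a) \<Rightarrow> nat \<Rightarrow> 'a" where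
  "descending_prod M g 0 = \<one>\<^bsub>M\<^esub>"
| "descending_prod M g (Suc k) = g (Suc k) \<otimes>\<^bsub>M\<^esub> descending_prod M g k"

lemma (in monoid) Units_r_cancel:
  assumes "u \<in> Units G" "a \<in> carrier G" "b \<in> carrier G" "a \<otimes> u = b \<otimes> u"
  shows "a = b"
  by (metis assms Units_closed Units_inv_closed Units_r_inv m_assoc r_one)

lemma (in monoid) UnitsI:
  assumes "a \<in> carrier G" "b \<in> carrier G" "a \<otimes> b = \<one>" "b \<otimes> a = \<one>"
  shows "a \<in> Units G"
  using assms by (auto simp: Units_def)

text \<open>Conjugation by \<open>u\<close> is multiplicative. Writing it as intertwining avoids an
  inverse, so the same lemma also serves for commuting elements.\<close>

lemma (in monoid) intertwine_mult:
  assumes "u \<in> carrier G" "a \<in> carrier G" "a' \<in> carrier G" "b \<in> carrier G" "b' \<in> carrier G"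
    and "u \<otimes> a = a' \<otimes> u" "u \<otimes> b = b' \<otimes> u"
  shows "u \<otimes> (a \<otimes> b) = a' \<otimes> b' \<otimes> u"
  by (metis assms m_assoc)

text \<open>Transport of an equation along conjugation by a unit: this is how relations involving
  the generator of index 0 are deduced from relations among positive indices.\<close>

lemma (in monoid) intertwine_eq:
  assumes "u \<in> Units G" "a' \<in> carrier G" "b' \<in> carrier G"
    and "u \<otimes> a = a' \<otimes> u" "u \<otimes> b = b' \<otimes> u" "a = b"
  shows "a' = b'"
  using Units_r_cancel[of u a' b'] assms by auto

text \<open>The part common to both presentations, isolated so that computations with descending
  words can be used in each direction.\<close>

locale braid_monoid = monoid +
  fixes n :: nat and g :: "nat \<Rightarrow> 'a"
  assumes g_closed [simp]: "\<And>i. 1 \<le> i \<Longrightarrow> i < n \<Longrightarrow> g i \<in> carrier G"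
    and g_comm: "\<And>i j. 1 \<le> i \<Longrightarrow> i + 2 \<le> j \<Longrightarrow> j < n \<Longrightarrow> g i \<otimes> g j = g j \<otimes> g i"
    and g_braid: "\<And>i. 1 \<le> i \<Longrightarrow> i + 1 < n \<Longrightarrow>
      g i \<otimes> g (i + 1) \<otimes> g i = g (i + 1) \<otimes> g i \<otimes> g (i + 1)"
begin

abbreviation V where "V k \<equiv> descending_prod G g k"
text \<open>The word \<open>g (k+1) ... g 2\<close>, that is, \<open>V (k+1)\<close> without its
  last letter \<open>g 1\<close>. All its letters have index at least 2, hence commute with
  X_1.\<close>

abbreviation U where "U k \<equiv> descending_prod G (\<lambda>i. g (Suc i)) k"

lemma V_closed [simp]: "k < n \<Longrightarrow> V k \<in> carrier G"
  by (induction k) auto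

lemma U_closed [simp]: "k + 1 < n \<or> k = 0 \<Longrightarrow> U k \<in> carrier G"
  by (induction k) auto

lemma V_Suc_eq_U: "Suc k < n \<Longrightarrow> V (Suc k) = U k \<otimes> g 1"
  by (induction k) (auto simp: m_assoc)

lemma V_comm_far: "k + 2 \<le> j \<Longrightarrow> j < n \<Longrightarrow> V k \<otimes> g j = g j \<otimes> V k"
proof (induction k)
  case (Suc k)
  have "V (Suc k) \<otimes> g j = g (Suc k) \<otimes> (V k \<otimes> g j)"
    using Suc.prems by (simp add: m_assoc)
  also have "\<dots> = (g (Suc k) \<otimes> g j) \<otimes> V k"
    using Suc by (simp add: m_assoc)
  also have "\<dots> = g j \<otimes> V (Suc k)"
    using Suc.prems by (simp add: g_comm m_assoc)
  finally show ?case .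
qed simp

text \<open>Moving left, \<open>g (i + 1)\<close> passes the letters below \<open>i\<close>, meets
  \<open>g (i + 1) g i\<close> and becomes \<open>g i\<close> by the braid relation, then passes the
  letters above \<open>i + 1\<close>.\<close>

lemma V_slide: "1 \<le> i \<Longrightarrow> i < k \<Longrightarrow> k < n \<Longrightarrow> V k \<otimes> g (i + 1) = g i \<otimes> V k"
proof (induction k)
  case (Suc k)
  show ?case
  proof (cases "i = k")
    case True
    then obtain m where m: "k = Suc m" using Suc.prems by (cases k) auto
    have [simp]: "g i \<in> carrier G" "g (Suc i) \<in> carrier G" "V m \<in> carrier G"
      "g (Suc m) \<in> carrier G" "g (Suc (Suc m)) \<in> carrier G"
      using Suc.prems True m by auto
    have "V (Suc k) \<otimes> g (i + 1) = g (i + 1) \<otimes> g i \<otimes> (V m \<otimes> g (i + 1))"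
      using m True by (simp add: m_assoc)
    also have "V m \<otimes> g (i + 1) = g (i + 1) \<otimes> V m"
      using Suc.prems True m by (intro V_comm_far) auto
    also have "g (i + 1) \<otimes> g i \<otimes> (g (i + 1) \<otimes> V m) = (g (i + 1) \<otimes> g i \<otimes> g (i + 1)) \<otimes> V m"
      by (simp add: m_assoc)
    also have "\<dots> = (g i \<otimes> g (i + 1) \<otimes> g i) \<otimes> V m"
      using g_braid[of i] Suc.prems by simp
    also have "\<dots> = g i \<otimes> V (Suc k)"
      using m True by (simp add: m_assoc)
    finally show ?thesis .
  next
    case False
    have [simp]: "g i \<in> carrier G" "g (Suc i) \<in> carrier G" "V k \<in> carrier G" "g (Suc k) \<in> carrier G"
      using Suc.prems False by auto
    have "V (Suc k) \<otimes> g (i + 1) = g (Suc k) \<otimes> (V k \<otimes> g (i + 1))"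
      by (simp add: m_assoc)
    also have "\<dots> = (g (Suc k) \<otimes> g i) \<otimes> V k"
      using Suc False by (simp add: m_assoc)
    also have "\<dots> = g i \<otimes> V (Suc k)"
      using Suc.prems False by (simp flip: g_comm add: m_assoc)
    finally show ?thesis .
  qed
qed simp

text \<open>By \<open>V_slide\<close>, each letter of \<open>U k\<close> passes leftwards through
  \<open>V m\<close> and loses one in its index; \<open>k < m\<close> keeps all letters in the range
  of that lemma.\<close>

lemma V_mult_U: "k < m \<Longrightarrow> m < n \<Longrightarrow> V m \<otimes> U k = V k \<otimes> V m"
proof (induction k)
  case (Suc k)
  have "V m \<otimes> U (Suc k) = V m \<otimes> g (Suc k + 1) \<otimes> U k"
    using Suc.prems by (simp add: m_assoc)
  also have "V m \<otimes> g (Suc k + 1) = g (Suc k) \<otimes> V m"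
    using Suc.prems by (intro V_slide) auto
  also have "g (Suc k) \<otimes> V m \<otimes> U k = g (Suc k) \<otimes> (V m \<otimes> U k)"
    using Suc.prems by (simp add: m_assoc)
  also have "\<dots> = V (Suc k) \<otimes> V m"
    using Suc by (simp add: m_assoc)
  finally show ?case .
qed simp

lemma V_square: "Suc k < n \<Longrightarrow> V (Suc k) \<otimes> V (Suc k) = g (Suc k) \<otimes> (V (Suc k) \<otimes> U k)"
  by (subst V_mult_U) (auto simp: m_assoc)

lemma V_Units: "(\<And>i. 1 \<le> i \<Longrightarrow> i < n \<Longrightarrow> g i \<in> Units G) \<Longrightarrow> k < n \<Longrightarrow> V k \<in> Units G"
  by (induction k) auto

lemma U_Units: "(\<And>i. 1 \<le> i \<Longrightarrow> i < n \<Longrightarrow> g i \<in> Units G) \<Longrightarrow> k + 1 < n \<or> k = 0 \<Longrightarrow> U k \<in> Units G"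
  by (induction k) auto

text \<open>\<open>V (n - 1)\<close> performs the shift on its own, so the only condition left for
  \<open>V (n - 1) x\<close> is on \<open>x\<close>. An equivalence is needed because one
  presentation supplies the shift and the other the commutation.\<close>

lemma V_mult_slide_iff:
  assumes "x \<in> carrier G" "1 \<le> i" "i + 1 < n" "V (n - 1) \<in> Units G"
  shows "V (n - 1) \<otimes> x \<otimes> g (i + 1) = g i \<otimes> (V (n - 1) \<otimes> x) \<longleftrightarrow> x \<otimes> g (i + 1) = g (i + 1) \<otimes> x"
proof -
  have "g i \<otimes> (V (n - 1) \<otimes> x) = V (n - 1) \<otimes> (g (i + 1) \<otimes> x)"
    using V_slide[of i "n - 1"] assms by (simp flip: m_assoc)
  moreover have "V (n - 1) \<otimes> x \<otimes> g (i + 1) = V (n - 1) \<otimes> (x \<otimes> g (i + 1))"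
    using assms by (simp add: m_assoc)
  ultimately show ?thesis
    using assms by (simp add: Units_l_cancel)
qed

text \<open>Here \<open>w\<close> plays the role of \<open>h\<^sub>\<rho>\<close>: since \<open>w s\<^sub>0 = s\<^bsub>n-1\<^esub> w\<close> with \<open>s\<^sub>0 = w g\<^sub>1 w\<^sup>-\<^sup>1\<close>, the last
  shift relation is the left-hand side.\<close>

lemma square_slide_iff:
  assumes x: "x \<in> carrier G" and n: "2 \<le> n"
    and units: "\<And>i. 1 \<le> i \<Longrightarrow> i < n \<Longrightarrow> g i \<in> Units G"
    and comm: "\<And>i. 2 \<le> i \<Longrightarrow> i < n \<Longrightarrow> x \<otimes> g i = g i \<otimes> x"
  defines "w \<equiv> V (n - 1) \<otimes> x"
  shows "w \<otimes> w \<otimes> g 1 = g (n - 1) \<otimes> (w \<otimes> w) \<longleftrightarrow> g 1 \<otimes> x \<otimes> g 1 \<otimes> x = x \<otimes> g 1 \<otimes> x \<otimes> g 1"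
proof -
  obtain k where k: "n = Suc (Suc k)" using n by (metis Suc_le_D numeral_2_eq_2 Suc_le_mono)
  have Vk: "V (n - 1) = V (Suc k)" using k by simp
  have [simp]: "g 1 \<in> carrier G" "g (Suc 0) \<in> carrier G" "U k \<in> carrier G" "V (Suc k) \<in> carrier G"
     "g (Suc k) \<in> carrier G"
    using k by (auto simp del: descending_prod.simps)
  note [simp] = x
  note [simp del] = descending_prod.simps
  have Ux: "x \<otimes> U j = U j \<otimes> x" if "j \<le> k" for j
    using that
  proof (induction j)
    case (Suc j)
    have [simp]: "U j \<in> carrier G" "g (Suc (Suc j)) \<in> carrier G" using Suc.prems k by auto
    have "x \<otimes> U (Suc j) = (x \<otimes> g (Suc (Suc j))) \<otimes> U j"
      by (simp add: m_assoc descending_prod.simps)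
    also have "\<dots> = g (Suc (Suc j)) \<otimes> (x \<otimes> U j)"
      using comm[of "Suc (Suc j)"] Suc.prems k by (simp add: m_assoc)
    also have "\<dots> = U (Suc j) \<otimes> x"
      using Suc by (simp add: m_assoc descending_prod.simps)
    finally show ?case .
  qed (simp add: descending_prod.simps)
  have VU: "V (Suc k) = U k \<otimes> g 1" using V_Suc_eq_U[of k] k by simp
  \<comment> \<open>Splitting the second \<open>V\<close> as \<open>U k\<close> times
    \<open>g 1\<close> lets \<open>x\<close> slide past \<open>U k\<close>. Both sides of the shift
    then acquire the left factor \<open>V (Suc k) U k\<close>, a unit, and cancelling it leaves the
    two sides of the four-letter relation.\<close>
  have "w \<otimes> w = V (Suc k) \<otimes> (x \<otimes> U k) \<otimes> g 1 \<otimes> x"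
    unfolding w_def Vk by (subst (2) VU) (simp add: m_assoc)
  also have "\<dots> = V (Suc k) \<otimes> U k \<otimes> (x \<otimes> g 1 \<otimes> x)"
    by (subst Ux) (simp_all add: m_assoc)
  finally have ww: "w \<otimes> w = V (Suc k) \<otimes> U k \<otimes> (x \<otimes> g 1 \<otimes> x)" .
  have "g (n - 1) \<otimes> (w \<otimes> w) = g (Suc k) \<otimes> (V (Suc k) \<otimes> U k) \<otimes> (x \<otimes> g 1 \<otimes> x)"
    using k by (simp add: ww m_assoc)
  also have "\<dots> = V (Suc k) \<otimes> V (Suc k) \<otimes> (x \<otimes> g 1 \<otimes> x)"
    using V_square[of k] k by simp
  also have "\<dots> = V (Suc k) \<otimes> U k \<otimes> (g 1 \<otimes> x \<otimes> g 1 \<otimes> x)"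
    by (subst (2) VU) (simp add: m_assoc)
  finally have *: "g (n - 1) \<otimes> (w \<otimes> w) = V (Suc k) \<otimes> U k \<otimes> (g 1 \<otimes> x \<otimes> g 1 \<otimes> x)" .
  have **: "w \<otimes> w \<otimes> g 1 = V (Suc k) \<otimes> U k \<otimes> (x \<otimes> g 1 \<otimes> x \<otimes> g 1)"
    by (simp add: ww m_assoc)
  have "V (Suc k) \<otimes> U k \<in> Units G"
    using V_Units[OF units, of "Suc k"] U_Units[OF units, of k] k by auto
  then show ?thesis
    unfolding * ** by (subst Units_l_cancel) auto
qed

end


section \<open>Two presentations of the affine Hecke algebra\<close>

locale coefficient_ring =
  fixes K :: "'k::comm_ring_1 set"
  assumes K_one: "1 \<in> K"
    and K_uminus: "c \<in> K \<Longrightarrow> - c \<in> K"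
    and K_add: "c \<in> K \<Longrightarrow> d \<in> K \<Longrightarrow> c + d \<in> K"
    and K_mult: "c \<in> K \<Longrightarrow> d \<in> K \<Longrightarrow> c * d \<in> K"
begin

lemma K_zero: "0 \<in> K"
  using K_add[OF K_one K_uminus[OF K_one]] by simp

lemma K_of_nat: "of_nat m \<in> K"
  by (induction m) (auto intro: K_zero K_one K_add)

end

text \<open>A K-algebra encoded as a ring with a central structure map, constrained only on
  \<open>K\<close>. This form passes directly to corners, where the map is multiplied by the
  idempotent, and to quotients, where it is the class of a constant.\<close>

locale scalar_algebra = ring B + coefficient_ring K
  for B :: "('a, 'b) ring_scheme" (structure) and K :: "'k::comm_ring_1 set" +
  fixes \<sigma> :: "'k \<Rightarrow> 'a"
  assumes scalar_closed [simp]: "c \<in> K \<Longrightarrow> \<sigma> c \<in> carrier B"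
    and scalar_one: "\<sigma> 1 = \<one>"
    and scalar_add: "c \<in> K \<Longrightarrow> d \<in> K \<Longrightarrow> \<sigma> (c + d) = \<sigma> c \<oplus> \<sigma> d"
    and scalar_mult: "c \<in> K \<Longrightarrow> d \<in> K \<Longrightarrow> \<sigma> (c * d) = \<sigma> c \<otimes> \<sigma> d"
    and scalar_central: "c \<in> K \<Longrightarrow> x \<in> carrier B \<Longrightarrow> \<sigma> c \<otimes> x = x \<otimes> \<sigma> c"
begin

lemma scalar_zero: "\<sigma> 0 = \<zero>"
proof -
  have "\<sigma> 0 = \<sigma> 0 \<oplus> \<sigma> 0"
    using scalar_add[OF K_zero K_zero] by simp
  then show ?thesis
    using K_zero by (metis add.l_cancel_one scalar_closed)
qed

lemma scalar_of_nat_mult: "x \<in> carrier B \<Longrightarrow> \<sigma> (of_nat m) \<otimes> x = [m] \<cdot> x"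
  by (induction m)
    (simp_all add: scalar_zero scalar_one scalar_add K_one K_of_nat l_distr a_comm)

end

text \<open>Images of the generators satisfying the defining relations, hence the data of a
  K-algebra homomorphism from H to \<open>B\<close>.\<close>

locale affine_hecke_rep = scalar_algebra B K \<sigma>
  for B :: "('a, 'b) ring_scheme" (structure) and K :: "'k::comm_ring_1 set" and \<sigma> :: "'k \<Rightarrow> 'a" +
  fixes z :: 'k and n :: nat and s :: "int \<Rightarrow> 'a" and w w' :: 'a
  assumes z_in_K [simp]: "z \<in> K"
    and s_closed [simp]: "i \<in> affine_indices n \<Longrightarrow> s i \<in> carrier B"
    and w_closed [simp]: "w \<in> carrier B" "w' \<in> carrier B"
    and w_inverse: "w \<otimes> w' = \<one>" "w' \<otimes> w = \<one>"
    and w_s: "i \<in> affine_indices n \<Longrightarrow> w \<otimes> s i = s ((i - 1) mod int n) \<otimes> w"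
    and s_comm: "i \<in> affine_indices n \<Longrightarrow> j \<in> affine_indices n \<Longrightarrow>
      \<not> [i - j = 1] (mod int n) \<Longrightarrow> \<not> [i - j = -1] (mod int n) \<Longrightarrow> s i \<otimes> s j = s j \<otimes> s i"
    and s_braid: "i \<in> affine_indices n \<Longrightarrow> 3 \<le> n \<Longrightarrow>
      s i \<otimes> s ((i + 1) mod int n) \<otimes> s i = s ((i + 1) mod int n) \<otimes> s i \<otimes> s ((i + 1) mod int n)"
    and s_square: "i \<in> affine_indices n \<Longrightarrow> s i \<otimes> s i = \<one> \<oplus> \<sigma> z \<otimes> s i"

text \<open>The relations of the affine Yokonuma--Hecke algebra with all \<open>t\<^sub>j = 1\<close>.\<close>

locale bernstein_hecke_rep = scalar_algebra B K \<sigma>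
  for B :: "('a, 'b) ring_scheme" (structure) and K :: "'k::comm_ring_1 set" and \<sigma> :: "'k \<Rightarrow> 'a" +
  fixes z :: 'k and n :: nat and g :: "nat \<Rightarrow> 'a" and x x' :: 'a
  assumes z_in_K [simp]: "z \<in> K"
    and g_closed [simp]: "\<And>i. 1 \<le> i \<Longrightarrow> i < n \<Longrightarrow> g i \<in> carrier B"
    and g_comm: "\<And>i j. 1 \<le> i \<Longrightarrow> i + 2 \<le> j \<Longrightarrow> j < n \<Longrightarrow> g i \<otimes> g j = g j \<otimes> g i"
    and g_braid: "\<And>i. 1 \<le> i \<Longrightarrow> i + 1 < n \<Longrightarrow>
      g i \<otimes> g (i + 1) \<otimes> g i = g (i + 1) \<otimes> g i \<otimes> g (i + 1)"
    and g_square: "\<And>i. 1 \<le> i \<Longrightarrow> i < n \<Longrightarrow> g i \<otimes> g i = \<one> \<oplus> \<sigma> z \<otimes> g i"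
    and x_closed [simp]: "x \<in> carrier B" "x' \<in> carrier B"
    and x_inverse: "x \<otimes> x' = \<one>" "x' \<otimes> x = \<one>"
    and x_g1: "1 < n \<Longrightarrow> g 1 \<otimes> x \<otimes> g 1 \<otimes> x = x \<otimes> g 1 \<otimes> x \<otimes> g 1"
    and x_g: "\<And>i. 2 \<le> i \<Longrightarrow> i < n \<Longrightarrow> g i \<otimes> x = x \<otimes> g i"

text \<open>The quadratic relation says \<open>a (a - z) = 1\<close>, and \<open>z\<close> acts
  centrally, so the inverse is \<open>a - z\<close>.\<close>

lemma (in scalar_algebra) hecke_generator_Units:
  assumes "a \<in> carrier B" "z \<in> K" "a \<otimes> a = \<one> \<oplus> \<sigma> z \<otimes> a"
  shows "a \<in> Units B"
proof (rule UnitsI)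
  have "a \<otimes> (a \<ominus> \<sigma> z) = a \<otimes> a \<ominus> \<sigma> z \<otimes> a"
    using assms by (simp add: r_distr minus_eq r_minus scalar_central)
  also have "\<dots> = \<one>"
    using assms(1,2) unfolding assms(3) by (simp add: a_assoc minus_eq r_neg)
  finally show "a \<otimes> (a \<ominus> \<sigma> z) = \<one>" .
  have "(a \<ominus> \<sigma> z) \<otimes> a = a \<otimes> a \<ominus> \<sigma> z \<otimes> a"
    using assms by (simp add: l_distr minus_eq l_minus)
  also have "\<dots> = \<one>"
    using assms(1,2) unfolding assms(3) by (simp add: a_assoc minus_eq r_neg)
  finally show "(a \<ominus> \<sigma> z) \<otimes> a = \<one>" .
qed (use assms in auto)

lemma affine_indices_iff: "i \<in> affine_indices n \<longleftrightarrow> n \<noteq> 1 \<and> 0 \<le> i \<and> i < int n"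
  by (auto simp: affine_indices_def)

section \<open>From h_rho to X_1\<close>

context affine_hecke_rep
begin

sublocale braid: braid_monoid B n "\<lambda>i. s (int i)"
proof
  fix i assume i: "1 \<le> i" "i < n"
  then show "s (int i) \<in> carrier B"
    by (simp add: affine_indices_iff)
next
  fix i j assume ij: "1 \<le> i" "i + 2 \<le> j" "j < n"
  show "s (int i) \<otimes> s (int j) = s (int j) \<otimes> s (int i)"
  proof (rule s_comm)
    \<comment> \<open>Both \<open>j - i + 1\<close> and \<open>j - i - 1\<close> lie strictly
      between 0 and \<open>n\<close>, so neither is divisible by \<open>n\<close>.\<close>
    show "\<not> [int i - int j = 1] (mod int n)" "\<not> [int i - int j = - 1] (mod int n)"
      using ij zdvd_imp_le[of "int n" "int j - int i + 1"] zdvd_imp_le[of "int n" "int j - int i - 1"]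
      by (auto simp: cong_iff_dvd_diff dvd_diff_commute algebra_simps)
  qed (use ij in \<open>auto simp: affine_indices_iff\<close>)
next
  fix i assume "1 \<le> i" "i + 1 < n"
  then show "s (int i) \<otimes> s (int (i + 1)) \<otimes> s (int i) = s (int (i + 1)) \<otimes> s (int i) \<otimes> s (int (i + 1))"
    using s_braid[of "int i"] by (auto simp: affine_indices_iff add.commute)
qed

lemma s_Units: "i \<in> affine_indices n \<Longrightarrow> s i \<in> Units B"
  using hecke_generator_Units[of "s i" z] s_square by auto

lemma V_Units: "braid.V (n - 1) \<in> Units B"
proof (cases "n = 0")
  case False
  then show ?thesis
    by (intro braid.V_Units s_Units) (auto simp: affine_indices_iff)
qed simp

text \<open>X_1 is found by solving h_rho = V X_1. The shifts of indices at least 2 become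
  commutation by \<open>V_mult_slide_iff\<close>; the shifts of 1 and 0 give the hypothesis of
  \<open>square_slide_iff\<close>.\<close>

lemma bernstein_hecke_rep:
  "bernstein_hecke_rep B K \<sigma> z n (\<lambda>i. s (int i)) (inv braid.V (n - 1) \<otimes> w) (w' \<otimes> braid.V (n - 1))"
proof -
  define v where "v = braid.V (n - 1)"
  define x where "x = inv v \<otimes> w"
  have [simp]: "v \<in> Units B" "v \<in> carrier B" "x \<in> carrier B"
    using V_Units by (auto simp: v_def x_def Units_closed)
  have vx: "braid.V (n - 1) \<otimes> x = w"
    unfolding x_def v_def[symmetric] by (simp flip: m_assoc)
  have x_s: "x \<otimes> s (int i) = s (int i) \<otimes> x" if "2 \<le> i" "i < n" for i
  proof -
    have "w \<otimes> s (int i) = s (int (i - 1)) \<otimes> w"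
      using w_s[of "int i"] that by (auto simp: affine_indices_iff of_nat_diff)
    then show ?thesis
      using braid.V_mult_slide_iff[of x "i - 1", unfolded vx] that V_Units by fastforce
  qed
  show ?thesis
    unfolding v_def[symmetric] x_def[symmetric]
  proof (unfold_locales; (fact braid.g_comm braid.g_braid)?)
    show "w' \<otimes> v \<in> carrier B" by simp
    have "x \<otimes> (w' \<otimes> v) = inv v \<otimes> (w \<otimes> w') \<otimes> v"
      by (simp add: x_def m_assoc)
    then show "x \<otimes> (w' \<otimes> v) = \<one>"
      by (simp add: w_inverse)
    have "w' \<otimes> v \<otimes> x = w' \<otimes> (v \<otimes> inv v) \<otimes> w"
      unfolding x_def by (simp add: m_assoc del: Units_r_inv)
    then show "w' \<otimes> v \<otimes> x = \<one>"
      by (simp add: w_inverse)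
    show "s (int i) \<otimes> s (int i) = \<one> \<oplus> \<sigma> z \<otimes> s (int i)" if "1 \<le> i" "i < n" for i
      using that by (intro s_square) (auto simp: affine_indices_iff)
    show "s (int i) \<otimes> x = x \<otimes> s (int i)" if "2 \<le> i" "i < n" for i
      using that by (simp add: x_s)
    assume n: "1 < n"
    have [simp]: "s 0 \<in> carrier B" "s 1 \<in> carrier B" "s (int (n - 1)) \<in> carrier B"
      using n by (auto simp: affine_indices_iff)
    \<comment> \<open>Two successive shifts, from 1 to 0 and from 0 around to
      \<open>n - 1\<close>.\<close>
    have "w \<otimes> w \<otimes> s 1 = w \<otimes> (s 0 \<otimes> w)"
      using w_s[of 1] n by (simp add: affine_indices_iff m_assoc)
    also have "\<dots> = s (int (n - 1)) \<otimes> (w \<otimes> w)"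
      using w_s[of 0] n by (simp add: affine_indices_iff zmod_minus1 of_nat_diff flip: m_assoc)
    finally show "s (int 1) \<otimes> x \<otimes> s (int 1) \<otimes> x = x \<otimes> s (int 1) \<otimes> x \<otimes> s (int 1)"
      using braid.square_slide_iff[of x, unfolded vx] n s_Units x_s
      by (simp add: affine_indices_iff)
  qed simp_all
qed

end

section \<open>From X_1 to h_rho and the generator of index 0\<close>

context bernstein_hecke_rep
begin

sublocale braid: braid_monoid B n g
  by unfold_locales (use g_comm g_braid in auto)

definition rho :: 'a where
  "rho = braid.V (n - 1) \<otimes> x"

text \<open>The value at 0 is forced by the shift relation at index 1, which then holds by
  construction.\<close>

definition affine_gen :: "int \<Rightarrow> 'a" where
  "affine_gen i = (if i = 0 then rho \<otimes> g 1 \<otimes> inv rho else g (nat i))"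

lemma g_Units: "1 \<le> i \<Longrightarrow> i < n \<Longrightarrow> g i \<in> Units B"
  using hecke_generator_Units[of "g i" z] g_square by auto

lemma rho_Units: "rho \<in> Units B"
proof (cases "n = 0")
  case False
  then have "braid.V (n - 1) \<in> Units B"
    by (intro braid.V_Units g_Units) auto
  then show ?thesis
    unfolding rho_def by (intro Units_m_closed UnitsI[of x x'] x_inverse x_closed)
next
  case True
  then show ?thesis
    unfolding rho_def by (intro Units_m_closed UnitsI[of x x'] x_inverse x_closed) simp
qed

text \<open>The relations among positive indices are hypotheses, and those with index 0 follow by
  conjugation with \<open>rho\<close>. The one shift that is neither a definition nor a slide is the
  wrap from 0 to \<open>n - 1\<close>, where \<open>x_g1\<close> enters.\<close>

lemma affine_hecke_rep: "affine_hecke_rep B K \<sigma> z n affine_gen rho (inv rho)"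
proof -
  have rho [simp]: "rho \<in> Units B" "rho \<in> carrier B" "inv rho \<in> carrier B"
    using rho_Units by auto
  have closed [simp]: "affine_gen i \<in> carrier B" if "i \<in> affine_indices n" for i
    using that by (auto simp: affine_gen_def affine_indices_iff)
  have pred: "(i - 1) mod int n \<in> affine_indices n" if "i \<in> affine_indices n" for i
    using that by (auto simp: affine_indices_iff)
  have shift: "rho \<otimes> affine_gen i = affine_gen ((i - 1) mod int n) \<otimes> rho"
    if i: "i \<in> affine_indices n" for i
  proof -
    have n: "2 \<le> n" using i by (auto simp: affine_indices_iff)
    have [simp]: "g 1 \<in> carrier B" "g (Suc 0) \<in> carrier B" "g (n - 1) \<in> carrier B" "g (n - Suc 0) \<in> carrier B"
      using n by auto
    consider "i = 0" | "i = 1" | "2 \<le> i" using i by (force simp: affine_indices_iff)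
    then show ?thesis
    proof cases
      case 1
      \<comment> \<open>Since the generator of index 0 is \<open>rho g_1 rho^(-1)\<close>, shifting
        it is the double shift of \<open>g 1\<close> followed by cancellation of one
        \<open>rho\<close>.\<close>
      have "rho \<otimes> rho \<otimes> g 1 = g (n - 1) \<otimes> (rho \<otimes> rho)"
        using braid.square_slide_iff[OF x_closed(1) n g_Units] n x_g x_g1
        by (simp add: rho_def)
      then have "rho \<otimes> (rho \<otimes> g 1 \<otimes> inv rho) = g (n - 1) \<otimes> (rho \<otimes> rho) \<otimes> inv rho"
        by (simp flip: m_assoc)
      also have "\<dots> = g (n - 1) \<otimes> rho"
        by (simp add: m_assoc)
      moreover have "nat (- 1 mod int n) = n - 1"
        using n by (simp add: zmod_minus1 nat_diff_distrib')
      moreover have "- 1 mod int n \<noteq> 0"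
        using n by (simp add: zmod_minus1)
      ultimately show ?thesis
        using 1 by (simp add: affine_gen_def)
    next
      case 2
      then show ?thesis
        using n by (simp add: affine_gen_def m_assoc)
    next
      case 3
      then obtain k where k: "i = int k + 1" "1 \<le> k" "k + 1 < n"
        using i by (intro that[of "nat i - 1"]) (auto simp: affine_indices_iff)
      have "braid.V (n - 1) \<in> Units B"
        using n by (intro braid.V_Units g_Units) auto
      then have "rho \<otimes> g (k + 1) = g k \<otimes> rho"
        using braid.V_mult_slide_iff[of x k] x_g[of "k + 1"] k by (simp add: rho_def)
      then show ?thesis
        using k by (simp add: affine_gen_def nat_add_distrib)
    qed
  qed
  have conj_mult: "rho \<otimes> (affine_gen i \<otimes> affine_gen j)
      = affine_gen ((i - 1) mod int n) \<otimes> affine_gen ((j - 1) mod int n) \<otimes> rho"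
    if "i \<in> affine_indices n" "j \<in> affine_indices n" for i j
    using that by (intro intertwine_mult shift) (auto intro: closed[OF pred])
  have conj_mult3: "rho \<otimes> (affine_gen i \<otimes> affine_gen j \<otimes> affine_gen i)
      = affine_gen ((i - 1) mod int n) \<otimes> affine_gen ((j - 1) mod int n) \<otimes> affine_gen ((i - 1) mod int n) \<otimes> rho"
    if "i \<in> affine_indices n" "j \<in> affine_indices n" for i j
    using that by (intro intertwine_mult[OF _ _ _ _ _ conj_mult] shift) (auto intro: closed[OF pred])
  have comm_pos: "affine_gen i \<otimes> affine_gen j = affine_gen j \<otimes> affine_gen i"
    if "1 \<le> i" "i + 2 \<le> j" "j < int n" for i j
    using g_comm[of "nat i" "nat j"] that by (auto simp: affine_gen_def nat_le_eq_zle)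
  \<comment> \<open>Conjugate of the pair \<open>(1, j + 1)\<close>; the bound on \<open>j\<close>
    keeps \<open>j + 1\<close> at most \<open>n - 1\<close>, where \<open>comm_pos\<close>
    applies.\<close>
  have comm0: "affine_gen 0 \<otimes> affine_gen j = affine_gen j \<otimes> affine_gen 0"
    if j: "2 \<le> j" "j + 2 \<le> int n" for j
  proof (rule intertwine_eq[of rho])
    show "affine_gen 1 \<otimes> affine_gen (j + 1) = affine_gen (j + 1) \<otimes> affine_gen 1"
      using j by (intro comm_pos) auto
    show "rho \<otimes> (affine_gen 1 \<otimes> affine_gen (j + 1)) = affine_gen 0 \<otimes> affine_gen j \<otimes> rho"
         "rho \<otimes> (affine_gen (j + 1) \<otimes> affine_gen 1) = affine_gen j \<otimes> affine_gen 0 \<otimes> rho"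
      using j conj_mult[of 1 "j + 1"] conj_mult[of "j + 1" 1] by (simp_all add: affine_indices_iff)
  qed (use j in \<open>auto simp: affine_indices_iff\<close>)
  have comm: "affine_gen i \<otimes> affine_gen j = affine_gen j \<otimes> affine_gen i"
    if "i \<in> affine_indices n" "j \<in> affine_indices n" "i < j"
      "\<not> [i - j = 1] (mod int n)" "\<not> [i - j = -1] (mod int n)" for i j
  proof -
    \<comment> \<open>The congruences exclude ordinary neighbours and also the cyclic pair
      \<open>(0, n - 1)\<close>.\<close>
    have "j \<noteq> i + 1" using that(5) by auto
    moreover have "i = 0 \<longrightarrow> j + 1 \<noteq> int n"
    proof (intro impI notI)
      assume "i = 0" "j + 1 = int n"
      then have "i - j = 1 - int n" by simp
      then show False
        using that(4) by (simp add: cong_iff_dvd_diff)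
    qed
    ultimately show ?thesis
      using comm_pos[of i j] comm0[of j] that by (cases "i = 0") (auto simp: affine_indices_iff)
  qed
  have braid_pos: "affine_gen i \<otimes> affine_gen (i + 1) \<otimes> affine_gen i
      = affine_gen (i + 1) \<otimes> affine_gen i \<otimes> affine_gen (i + 1)"
    if "1 \<le> i" "i + 1 < int n" for i
    using g_braid[of "nat i"] that by (auto simp: affine_gen_def nat_add_distrib)
  have braid_pred: "affine_gen i' \<otimes> affine_gen j' \<otimes> affine_gen i'
      = affine_gen j' \<otimes> affine_gen i' \<otimes> affine_gen j'"
    if "i \<in> affine_indices n" "j \<in> affine_indices n" "i' = (i - 1) mod int n" "j' = (j - 1) mod int n"
      "affine_gen i \<otimes> affine_gen j \<otimes> affine_gen i = affine_gen j \<otimes> affine_gen i \<otimes> affine_gen j"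
    for i j i' j'
    unfolding that(3,4)
    by (rule intertwine_eq[OF rho(1) _ _ conj_mult3[OF that(1,2)] conj_mult3[OF that(2,1)] that(5)])
      (intro m_closed closed pred that(1,2))+
  have braid: "affine_gen i \<otimes> affine_gen ((i + 1) mod int n) \<otimes> affine_gen i
      = affine_gen ((i + 1) mod int n) \<otimes> affine_gen i \<otimes> affine_gen ((i + 1) mod int n)"
    if i: "i \<in> affine_indices n" and n: "3 \<le> n" for i
  proof -
    \<comment> \<open>The pair \<open>(0, 1)\<close> is the conjugate of \<open>(1, 2)\<close>, and
      2 is an index because \<open>n\<close> is at least 3. In the last case below, the cyclic pair
      \<open>(n - 1, 0)\<close> is in turn the conjugate of \<open>(0, 1)\<close>.\<close>
    have braid0: "affine_gen 0 \<otimes> affine_gen 1 \<otimes> affine_gen 0 = affine_gen 1 \<otimes> affine_gen 0 \<otimes> affine_gen 1"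
      using n braid_pos[of 1] by - (rule braid_pred[of 1 2], auto simp: affine_indices_iff)
    consider "i = 0" | "1 \<le> i" "i + 1 < int n" | "i = int n - 1"
      using i by (force simp: affine_indices_iff)
    then show ?thesis
    proof cases
      case 3
      then show ?thesis
        using n braid0 by - (rule braid_pred[of 0 1], auto simp: affine_indices_iff zmod_minus1)
    qed (use n braid0 braid_pos in auto)
  qed
  have square_pos: "affine_gen i \<otimes> affine_gen i = \<one> \<oplus> \<sigma> z \<otimes> affine_gen i"
    if "1 \<le> i" "i < int n" for i
    using g_square[of "nat i"] that by (auto simp: affine_gen_def)
  have square0: "affine_gen 0 \<otimes> affine_gen 0 = \<one> \<oplus> \<sigma> z \<otimes> affine_gen 0" if "2 \<le> n"
  proof -
    have [simp]: "affine_gen 0 \<in> carrier B" "affine_gen 1 \<in> carrier B"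
      using that by (auto simp: affine_indices_iff)
    have "rho \<otimes> (\<sigma> z \<otimes> affine_gen 1) = \<sigma> z \<otimes> affine_gen 0 \<otimes> rho"
      using that shift[of 1] by (intro intertwine_mult) (auto simp: affine_indices_iff scalar_central)
    then have 1: "rho \<otimes> (\<one> \<oplus> \<sigma> z \<otimes> affine_gen 1) = (\<one> \<oplus> \<sigma> z \<otimes> affine_gen 0) \<otimes> rho"
      by (simp add: r_distr l_distr)
    have 2: "rho \<otimes> (affine_gen 1 \<otimes> affine_gen 1) = affine_gen 0 \<otimes> affine_gen 0 \<otimes> rho"
      using that conj_mult[of 1 1] by (simp add: affine_indices_iff)
    show ?thesis
      by (rule intertwine_eq[OF rho(1) _ _ 2 1 square_pos]) (use that in auto)
  qed
  show ?thesis
  proof unfold_locales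
    show "affine_gen i \<otimes> affine_gen j = affine_gen j \<otimes> affine_gen i"
      if "i \<in> affine_indices n" "j \<in> affine_indices n"
        "\<not> [i - j = 1] (mod int n)" "\<not> [i - j = -1] (mod int n)" for i j
    proof -
      have "\<not> [j - i = 1] (mod int n)" "\<not> [j - i = -1] (mod int n)"
        using that(3,4) cong_minus_minus_iff[of "j - i" 1 "int n"] cong_minus_minus_iff[of "j - i" "-1" "int n"]
        by simp_all
      then show ?thesis
        using comm[OF that(1,2) _ that(3,4)] comm[OF that(2,1)]
        by (cases i j rule: linorder_cases) simp_all
    qed
    show "affine_gen i \<otimes> affine_gen i = \<one> \<oplus> \<sigma> z \<otimes> affine_gen i" if "i \<in> affine_indices n" for i
      using that square0 square_pos[of i] by (cases "i = 0") (simp_all add: affine_indices_iff)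
  qed (auto intro: shift braid)
qed

end


section \<open>The unit idempotent of the affine Yokonuma--Hecke algebra\<close>

text \<open>All images are scalars and the reflections share one value, so only the quadratic
  relation is a condition, and it is the equation assumed for \<open>q\<close>.\<close>

lemma (in scalar_algebra) trivial_affine_hecke_rep:
  assumes "z \<in> K" "q \<in> K" "q * q = 1 + z * q"
  shows "affine_hecke_rep B K \<sigma> z n (\<lambda>_. \<sigma> q) \<one> \<one>"
  using assms scalar_add[of 1 "z * q"] scalar_mult[of q q] scalar_mult[of z q]
  by unfold_locales (auto simp: K_one K_mult scalar_one)

text \<open>The scalar \<open>a\<close> stands for 1/r, and the idempotent e_i appears expanded
  inside \<open>g_square\<close>.\<close>

locale yokonuma_rep = scalar_algebra B K \<sigma>
  for B :: "('a, 'b) ring_scheme" (structure) and K :: "'k::comm_ring_1 set" and \<sigma> :: "'k \<Rightarrow> 'a" +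
  fixes z a :: 'k and r n :: nat and t g :: "nat \<Rightarrow> 'a" and x x' :: 'a
  assumes z_in_K [simp]: "z \<in> K"
    and a_in_K [simp]: "a \<in> K"
    and a_inverse: "a * of_nat r = 1"
    and t_closed [simp]: "\<And>j. j \<in> {1..n} \<Longrightarrow> t j \<in> carrier B"
    and g_closed [simp]: "\<And>i. i \<in> {1..<n} \<Longrightarrow> g i \<in> carrier B"
    and x_closed [simp]: "x \<in> carrier B" "x' \<in> carrier B"
    and g_comm: "\<And>i j. i \<in> {1..<n} \<Longrightarrow> j \<in> {1..<n} \<Longrightarrow> \<bar>int i - int j\<bar> \<ge> 2 \<Longrightarrow> g i \<otimes> g j = g j \<otimes> g i"
    and g_braid: "\<And>i. 1 \<le> i \<Longrightarrow> i + 1 < n \<Longrightarrow>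
      g i \<otimes> g (i + 1) \<otimes> g i = g (i + 1) \<otimes> g i \<otimes> g (i + 1)"
    and t_comm: "\<And>i j. i \<in> {1..n} \<Longrightarrow> j \<in> {1..n} \<Longrightarrow> t i \<otimes> t j = t j \<otimes> t i"
    and g_t: "\<And>i j. i \<in> {1..<n} \<Longrightarrow> j \<in> {1..n} \<Longrightarrow>
      g i \<otimes> t j = t (Transposition.transpose i (i + 1) j) \<otimes> g i"
    and t_power: "\<And>j. j \<in> {1..n} \<Longrightarrow> t j [^] r = \<one>"
    and g_square: "\<And>i. i \<in> {1..<n} \<Longrightarrow> g i \<otimes> g i =
      \<one> \<oplus> \<sigma> z \<otimes> (\<sigma> a \<otimes> (\<Oplus>s\<in>{..<r}. t i [^] s \<otimes> t (i + 1) [^] (r - s))) \<otimes> g i"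
    and x_inverse: "x \<otimes> x' = \<one>" "x' \<otimes> x = \<one>"
    and x_g1: "1 < n \<Longrightarrow> g 1 \<otimes> x \<otimes> g 1 \<otimes> x = x \<otimes> g 1 \<otimes> x \<otimes> g 1"
    and x_g: "\<And>i. 2 \<le> i \<Longrightarrow> i < n \<Longrightarrow> g i \<otimes> x = x \<otimes> g i"
    and t_x: "\<And>j. j \<in> {1..n} \<Longrightarrow> t j \<otimes> x = x \<otimes> t j"

text \<open>The sum is \<open>r\<close> times \<open>b\<close>, and \<open>a\<close> inverts
  \<open>r\<close>. This evaluates e_i and the averages wherever the \<open>t j\<close> act
  trivially.\<close>

lemma (in scalar_algebra) average_const:
  assumes "a \<in> K" "a * of_nat r = 1" "b \<in> carrier B" "\<And>s. s < r \<Longrightarrow> f s = b"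
  shows "\<sigma> a \<otimes> (\<Oplus>s\<in>{..<r}. f s) = b"
proof -
  have "(\<Oplus>s\<in>{..<r}. f s) = (\<Oplus>s\<in>{..<r}. b)"
    using assms by (intro finsum_cong') auto
  also have "\<dots> = \<sigma> (of_nat r) \<otimes> b"
    using assms(3) add.finprod_const[of b "{..<r}"]
    by (simp add: finsum_def add_pow_def scalar_of_nat_mult)
  moreover have "\<sigma> a \<otimes> \<sigma> (of_nat r) = \<one>"
    using assms scalar_mult[of a "of_nat r"] K_of_nat[of r] by (simp add: scalar_one)
  ultimately show ?thesis
    using assms(1,3) K_of_nat[of r] by (simp flip: m_assoc)
qed

text \<open>With every \<open>t j\<close> equal to 1 the idempotents e_i become 1, so the quadratic
  relation of Y is that of H. This is the source of \<psi>.\<close>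

lemma (in bernstein_hecke_rep) yokonuma_rep:
  assumes a: "a \<in> K" "a * of_nat r = 1"
  shows "yokonuma_rep B K \<sigma> z a r n (\<lambda>_. \<one>) g x x'"
proof unfold_locales
  fix i j assume "i \<in> {1..<n}" "j \<in> {1..<n}" "\<bar>int i - int j\<bar> \<ge> 2"
  then show "g i \<otimes> g j = g j \<otimes> g i"
    using g_comm[of i j] g_comm[of j i] by (cases i j rule: linorder_cases) auto
next
  fix i assume "i \<in> {1..<n}"
  then show "g i \<otimes> g i =
      \<one> \<oplus> \<sigma> z \<otimes> (\<sigma> a \<otimes> (\<Oplus>s\<in>{..<r}. \<one> [^] s \<otimes> \<one> [^] (r - s))) \<otimes> g i"
    using a by (subst average_const[of _ _ \<one>]) (auto simp: g_square)
qed (use a g_braid x_inverse x_g1 x_g in auto)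

text \<open>For an idempotent \<open>e\<close> this is the Peirce corner \<open>e B e\<close>, a
  ring whose unit is \<open>e\<close>. Describing its elements by fixed-point equations makes
  membership a direct check.\<close>

definition corner :: "('a, 'b) ring_scheme \<Rightarrow> 'a \<Rightarrow> ('a, 'b) ring_scheme" where
  "corner B e = B\<lparr>carrier := {b \<in> carrier B. e \<otimes>\<^bsub>B\<^esub> b = b \<and> b \<otimes>\<^bsub>B\<^esub> e = b}, one := e\<rparr>"

lemma corner_simps [simp]:
  "b \<in> carrier (corner B e) \<longleftrightarrow> b \<in> carrier B \<and> e \<otimes>\<^bsub>B\<^esub> b = b \<and> b \<otimes>\<^bsub>B\<^esub> e = b"
  "monoid.mult (corner B e) = monoid.mult B" "one (corner B e) = e"
  "add (corner B e) = add B" "ring.zero (corner B e) = ring.zero B"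
  by (simp_all add: corner_def)

lemma (in ring) ring_corner:
  assumes "e \<in> carrier R" "e \<otimes> e = e"
  shows "ring (corner R e)"
proof (rule ringI)
  show "abelian_group (corner R e)"
  proof (rule abelian_groupI)
    fix b assume "b \<in> carrier (corner R e)"
    then show "\<exists>c\<in>carrier (corner R e). c \<oplus>\<^bsub>corner R e\<^esub> b = \<zero>\<^bsub>corner R e\<^esub>"
      using assms by (intro bexI[of _ "\<ominus> b"]) (auto simp: l_neg l_minus r_minus)
  qed (use assms in \<open>auto simp: a_ac l_distr r_distr\<close>)
  show "Group.monoid (corner R e)"
  proof (rule monoidI)
    fix b c assume "b \<in> carrier (corner R e)" "c \<in> carrier (corner R e)"
    then show "b \<otimes>\<^bsub>corner R e\<^esub> c \<in> carrier (corner R e)"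
      using assms(1) by (auto simp: m_assoc) (simp flip: m_assoc)
  qed (use assms in \<open>auto simp: m_assoc\<close>)
qed (auto simp: l_distr r_distr)

lemma (in scalar_algebra) scalar_algebra_corner:
  assumes e: "e \<in> carrier B" "e \<otimes> e = e"
  shows "scalar_algebra (corner B e) K (\<lambda>c. \<sigma> c \<otimes> e)"
proof -
  interpret corner: ring "corner B e"
    using e by (rule ring_corner)
  have e_scalar: "e \<otimes> (\<sigma> c \<otimes> e) = \<sigma> c \<otimes> e" if "c \<in> K" for c
    using that e scalar_central[of c e] by (metis m_assoc scalar_closed)
  show ?thesis
  proof unfold_locales
    fix c d assume "c \<in> K" "d \<in> K"
    then show "\<sigma> (c * d) \<otimes> e = \<sigma> c \<otimes> e \<otimes>\<^bsub>corner B e\<^esub> (\<sigma> d \<otimes> e)"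
      using e e_scalar[of d] by (simp add: scalar_mult m_assoc)
  next
    fix c b assume "c \<in> K" "b \<in> carrier (corner B e)"
    then show "\<sigma> c \<otimes> e \<otimes>\<^bsub>corner B e\<^esub> b = b \<otimes>\<^bsub>corner B e\<^esub> (\<sigma> c \<otimes> e)"
      using e scalar_central[of c e] scalar_central[of c b]
      by (simp add: m_assoc) (metis m_assoc scalar_closed)
  qed (use e e_scalar in \<open>auto simp: K_one K_uminus K_add K_mult scalar_one scalar_add l_distr m_assoc\<close>)
qed

section \<open>The averaging idempotent and its corner\<close>

context yokonuma_rep
begin

lemma r_pos: "r \<noteq> 0"
  using a_inverse by (metis mult_zero_right of_nat_0 zero_neq_one)

text \<open>The idempotent of the trivial character of the cyclic group generated by
  \<open>t j\<close>: multiplication by it projects onto what \<open>t j\<close> fixes.\<close>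

definition average :: "nat \<Rightarrow> 'a" where
  "average j = \<sigma> a \<otimes> (\<Oplus>s\<in>{..<r}. t j [^] s)"

text \<open>The idempotent e: as the averages commute, their product belongs to the trivial
  character of the whole group generated by the \<open>t j\<close>.\<close>

definition unit_idem :: 'a where
  "unit_idem = descending_prod B average n"

lemma average_closed [simp]: "j \<in> {1..n} \<Longrightarrow> average j \<in> carrier B"
  by (auto simp: average_def)

lemma t_average:
  assumes j: "j \<in> {1..n}"
  shows "t j \<otimes> average j = average j"
proof -
  obtain m where m: "r = Suc m" using r_pos by (cases r) auto
  have [simp]: "t j \<in> carrier B" using j by simp
  \<comment> \<open>Multiplication by \<open>t j\<close> permutes the powers cyclically. Adding 1 to
    either sum gives the sum of the powers with exponents 0 to \<open>r\<close>, because
    \<open>t j\<close> to the power \<open>r\<close> is 1; cancelling the 1 proves equality.\<close>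
  have "(\<Oplus>s\<in>{..<r}. t j [^] Suc s) \<oplus> \<one> = (\<Oplus>s\<in>{..Suc m}. t j [^] s)"
    unfolding m lessThan_Suc_atMost by (subst finsum_Suc2) auto
  also have "\<dots> = \<one> \<oplus> (\<Oplus>s\<in>{..<r}. t j [^] s)"
    unfolding m lessThan_Suc_atMost using t_power[OF j] m by (subst finsum_Suc) (auto simp del: nat_pow_Suc)
  also have "\<dots> = (\<Oplus>s\<in>{..<r}. t j [^] s) \<oplus> \<one>"
    by (simp add: a_comm)
  finally have *: "(\<Oplus>s\<in>{..<r}. t j [^] Suc s) = (\<Oplus>s\<in>{..<r}. t j [^] s)"
    by (simp del: nat_pow_Suc)
  have "t j \<otimes> average j = \<sigma> a \<otimes> (t j \<otimes> (\<Oplus>s\<in>{..<r}. t j [^] s))"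
    using scalar_central[of a "t j"] by (simp add: average_def flip: m_assoc)
  also have "t j \<otimes> (\<Oplus>s\<in>{..<r}. t j [^] s) = (\<Oplus>s\<in>{..<r}. t j [^] Suc s)"
    by (subst finsum_rdistr) (auto simp flip: nat_pow_Suc2 intro!: finsum_cong')
  finally show ?thesis
    by (simp only: * average_def)
qed

lemma average_fix:
  assumes "j \<in> {1..n}" "b \<in> carrier B" "t j \<otimes> b = b"
  shows "average j \<otimes> b = b"
proof -
  have pow: "t j [^] (s::nat) \<otimes> b = b" for s
    using assms by (induction s) (auto simp: m_assoc)
  have "average j \<otimes> b = \<sigma> a \<otimes> (\<Oplus>s\<in>{..<r}. t j [^] s \<otimes> b)"
    using assms by (simp add: average_def m_assoc finsum_ldistr)
  then show ?thesis
    using assms by (simp add: pow average_const a_inverse)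
qed

text \<open>Used with equal indices for commutation, and with \<open>i\<close> and
  \<open>i + 1\<close> to see that \<open>g i\<close> interchanges two averages.\<close>

lemma average_intertwine:
  assumes b: "b \<in> carrier B" and j: "i \<in> {1..n}" "j \<in> {1..n}" and "b \<otimes> t i = t j \<otimes> b"
  shows "b \<otimes> average i = average j \<otimes> b"
proof -
  have [simp]: "t i \<in> carrier B" "t j \<in> carrier B" using j by auto
  have pow: "b \<otimes> t i [^] (s::nat) = t j [^] s \<otimes> b" for s
  proof (induction s)
    case (Suc s)
    then show ?case
      using intertwine_mult[of b "t i [^] s" "t j [^] s" "t i" "t j"] assms by simp
  qed (use b in simp)
  have "b \<otimes> average i = \<sigma> a \<otimes> (b \<otimes> (\<Oplus>s\<in>{..<r}. t i [^] s))"
    using b scalar_central[of a b] by (simp add: average_def flip: m_assoc)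
  also have "b \<otimes> (\<Oplus>s\<in>{..<r}. t i [^] s) = (\<Oplus>s\<in>{..<r}. t j [^] s) \<otimes> b"
    using b by (simp add: finsum_rdistr finsum_ldistr pow)
  finally show ?thesis
    using b by (simp add: average_def m_assoc)
qed

lemma prefix_closed [simp]: "k \<le> n \<Longrightarrow> descending_prod B average k \<in> carrier B"
  by (induction k) auto

lemma unit_idem_closed [simp]: "unit_idem \<in> carrier B"
  by (simp add: unit_idem_def)

lemma prefix_comm:
  assumes b: "b \<in> carrier B" and comm: "\<And>j. j \<in> {1..k} \<Longrightarrow> b \<otimes> t j = t j \<otimes> b" and "k \<le> n"
  shows "b \<otimes> descending_prod B average k = descending_prod B average k \<otimes> b"
  using comm \<open>k \<le> n\<close>
proof (induction k)
  case (Suc k)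
  then have "b \<otimes> average (Suc k) = average (Suc k) \<otimes> b"
    by (intro average_intertwine b) auto
  then show ?case
    using Suc b unfolding descending_prod.simps by (intro intertwine_mult) auto
qed (use b in simp)

lemma t_prefix: "1 \<le> j \<Longrightarrow> j \<le> k \<Longrightarrow> k \<le> n \<Longrightarrow> t j \<otimes> descending_prod B average k = descending_prod B average k"
proof (induction k)
  case (Suc k)
  show ?case
  proof (cases "j = Suc k")
    case True
    then show ?thesis
      using Suc.prems t_average[of j] by (simp flip: m_assoc)
  next
    case False
    have "t j \<otimes> average (Suc k) = average (Suc k) \<otimes> t j"
      using Suc.prems by (intro average_intertwine t_comm) auto
    then have "t j \<otimes> descending_prod B average (Suc k) = average (Suc k) \<otimes> (t j \<otimes> descending_prod B average k)"
      using Suc.prems by (simp flip: m_assoc)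
    then show ?thesis
      using Suc False by simp
  qed
qed simp

lemma t_unit_idem: "j \<in> {1..n} \<Longrightarrow> t j \<otimes> unit_idem = unit_idem"
  by (auto simp: unit_idem_def intro: t_prefix)

text \<open>Each \<open>t j\<close> fixes e, hence so does each average, and the factors of the left
  copy are absorbed one at a time.\<close>

lemma unit_idem_idem: "unit_idem \<otimes> unit_idem = unit_idem"
proof -
  have "k \<le> n \<Longrightarrow> descending_prod B average k \<otimes> unit_idem = unit_idem" for k
    by (induction k) (auto simp: m_assoc intro!: average_fix t_unit_idem)
  then show ?thesis
    by (simp add: unit_idem_def)
qed

lemma x_unit_idem: "x \<otimes> unit_idem = unit_idem \<otimes> x"
  unfolding unit_idem_def by (intro prefix_comm) (auto simp: t_x)

lemma x'_unit_idem: "x' \<otimes> unit_idem = unit_idem \<otimes> x'"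
proof -
  have "x' \<otimes> (x \<otimes> unit_idem) \<otimes> x' = x' \<otimes> (unit_idem \<otimes> x) \<otimes> x'"
    by (simp add: x_unit_idem)
  then show ?thesis
    by (simp add: m_assoc x_inverse) (simp add: x_inverse flip: m_assoc)
qed

text \<open>\<open>g i\<close> interchanges the averages at \<open>i\<close> and
  \<open>i + 1\<close> and commutes with the others; since the averages commute, their product is
  unchanged.\<close>

lemma g_unit_idem:
  assumes i: "i \<in> {1..<n}"
  shows "g i \<otimes> unit_idem = unit_idem \<otimes> g i"
proof -
  have [simp]: "g i \<in> carrier B" using i by simp
  have far: "g i \<otimes> average j = average j \<otimes> g i" if "j \<in> {1..n}" "j \<noteq> i" "j \<noteq> i + 1" for j
    using g_t[of i j] that i by (intro average_intertwine) auto
  have swap: "g i \<otimes> average i = average (i + 1) \<otimes> g i" "g i \<otimes> average (i + 1) = average i \<otimes> g i"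
    using g_t[of i i] g_t[of i "i + 1"] i by (auto intro!: average_intertwine)
  have "g i \<otimes> descending_prod B average k = descending_prod B average k \<otimes> g i"
    if "i + 1 \<le> k" "k \<le> n" for k
    using that
  proof (induction k rule: dec_induct)
    case base
    \<comment> \<open>The induction starts at the shortest prefix containing both interchanged
      factors; the remaining factors, with indices up to \<open>m = i - 1\<close>, commute with
      \<open>g i\<close>.\<close>
    obtain m where m: "i = Suc m" using i by (cases i) auto
    have "g i \<otimes> descending_prod B average m = descending_prod B average m \<otimes> g i"
      using i m g_t[of i] by (intro prefix_comm) auto
    then have "g i \<otimes> (average (i + 1) \<otimes> average i \<otimes> descending_prod B average m)
        = average i \<otimes> average (i + 1) \<otimes> descending_prod B average m \<otimes> g i"
      using swap i m by (intro intertwine_mult) auto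
    moreover have "average i \<otimes> average (i + 1) = average (i + 1) \<otimes> average i"
      using i by (intro average_intertwine average_intertwine[symmetric] t_comm) auto
    ultimately show ?case
      using i m by (simp add: m_assoc)
  next
    case (step k)
    then show ?case
      using far[of "Suc k"] unfolding descending_prod.simps by (intro intertwine_mult) auto
  qed
  then show ?thesis
    using i by (auto simp: unit_idem_def)
qed

text \<open>Because e commutes with \<open>g i\<close>, \<open>x\<close> and \<open>x'\<close>,
  products of elements \<open>b e\<close> are computed on the factors \<open>b\<close>. In the
  quadratic relation e_i e = e, since both \<open>t i\<close> and \<open>t (i + 1)\<close> fix e,
  and the Hecke relation remains.\<close>

lemma bernstein_hecke_rep_corner:
  "bernstein_hecke_rep (corner B unit_idem) K (\<lambda>c. \<sigma> c \<otimes> unit_idem) z n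
     (\<lambda>i. g i \<otimes> unit_idem) (x \<otimes> unit_idem) (x' \<otimes> unit_idem)"
proof -
  let ?e = unit_idem
  interpret corner: scalar_algebra "corner B ?e" K "\<lambda>c. \<sigma> c \<otimes> ?e"
    by (intro scalar_algebra_corner unit_idem_idem unit_idem_closed)
  have mult: "(b \<otimes> ?e) \<otimes> (c \<otimes> ?e) = (b \<otimes> c) \<otimes> ?e"
    if "b \<in> carrier B" "c \<in> carrier B" "c \<otimes> ?e = ?e \<otimes> c" for b c
  proof -
    have "(b \<otimes> ?e) \<otimes> (c \<otimes> ?e) = b \<otimes> (?e \<otimes> c) \<otimes> ?e"
      using that(1,2) by (simp add: m_assoc)
    also have "\<dots> = (b \<otimes> c) \<otimes> (?e \<otimes> ?e)"
      using that by (simp add: m_assoc flip: that(3))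
    finally show ?thesis by (simp add: unit_idem_idem)
  qed
  have in_corner: "?e \<otimes> (b \<otimes> ?e) = b \<otimes> ?e" "b \<otimes> ?e \<otimes> ?e = b \<otimes> ?e"
    if "b \<in> carrier B" "b \<otimes> ?e = ?e \<otimes> b" for b
  proof -
    show *: "b \<otimes> ?e \<otimes> ?e = b \<otimes> ?e"
      using that(1) by (simp add: m_assoc unit_idem_idem)
    show "?e \<otimes> (b \<otimes> ?e) = b \<otimes> ?e"
      using that by (metis * m_assoc unit_idem_closed)
  qed
  note gx = g_unit_idem[symmetric] x_unit_idem[symmetric] x'_unit_idem[symmetric]
  have square: "g i \<otimes> g i \<otimes> ?e = ?e \<oplus> \<sigma> z \<otimes> ?e \<otimes> (g i \<otimes> ?e)" if i: "i \<in> {1..<n}" for i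
  proof -
    let ?avg = "\<sigma> a \<otimes> (\<Oplus>s\<in>{..<r}. t i [^] s \<otimes> t (i + 1) [^] (r - s))"
    have [simp]: "g i \<in> carrier B" "t i \<in> carrier B" "t (i + 1) \<in> carrier B" "t (Suc i) \<in> carrier B"
      using i by auto
    have pow: "t j [^] (s::nat) \<otimes> ?e = ?e" if "j \<in> {1..n}" for j s
      using that t_unit_idem by (induction s) (auto simp: m_assoc)
    have "?avg \<otimes> ?e = \<sigma> a \<otimes> (\<Oplus>s\<in>{..<r}. t i [^] s \<otimes> t (i + 1) [^] (r - s) \<otimes> ?e)"
      by (simp add: m_assoc finsum_ldistr)
    also have "\<dots> = ?e"
      using i by (intro average_const a_inverse) (auto simp: m_assoc pow)
    finally have avg: "?avg \<otimes> ?e = ?e" .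
    have "g i \<otimes> g i \<otimes> ?e = ?e \<oplus> \<sigma> z \<otimes> (?avg \<otimes> (g i \<otimes> ?e))"
      using g_square[OF i] by (simp add: l_distr m_assoc)
    also have "?avg \<otimes> (g i \<otimes> ?e) = ?e \<otimes> g i"
      unfolding g_unit_idem[OF i] by (subst m_assoc[symmetric]) (use avg in auto)
    also have "\<dots> = ?e \<otimes> (g i \<otimes> ?e)"
      using i by (simp add: in_corner gx)
    finally show ?thesis
      by (simp add: m_assoc)
  qed
  show ?thesis
  proof unfold_locales
    show "g i \<otimes> ?e \<otimes>\<^bsub>corner B ?e\<^esub> (g j \<otimes> ?e) = g j \<otimes> ?e \<otimes>\<^bsub>corner B ?e\<^esub> (g i \<otimes> ?e)"
      if "1 \<le> i" "i + 2 \<le> j" "j < n" for i j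
      using that g_comm[of i j] by (simp add: mult gx)
    show "g i \<otimes> ?e \<otimes>\<^bsub>corner B ?e\<^esub> (g i \<otimes> ?e)
       = \<one>\<^bsub>corner B ?e\<^esub> \<oplus>\<^bsub>corner B ?e\<^esub> \<sigma> z \<otimes> ?e \<otimes>\<^bsub>corner B ?e\<^esub> (g i \<otimes> ?e)"
      if "1 \<le> i" "i < n" for i
      using that square[of i] by (simp add: mult gx)
  qed (use g_braid x_inverse x_g1 x_g in \<open>auto simp: mult gx in_corner\<close>)
qed

end


section \<open>Algebras given by generators and relations\<close>

text \<open>The presented algebra is a module record while the quotient is a ring record, so the
  axioms are carried over field by field instead of by an equality of records.\<close>

lemma ring_cong:
  assumes "ring R" "carrier S = carrier R" "monoid.mult S = monoid.mult R" "one S = one R"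
    "ring.zero S = ring.zero R" "add S = add R"
  shows "ring S"
proof -
  interpret R: ring R by fact
  show ?thesis
  proof (rule ringI)
    show "abelian_group S"
      by (rule abelian_groupI)
        (use assms(2-) R.a_ac R.l_neg in \<open>auto intro!: bexI[of _ "\<ominus>\<^bsub>R\<^esub> _"] simp: R.a_ac\<close>)
    show "Group.monoid S"
      by (rule monoidI) (use assms(2-) in \<open>auto simp: R.m_assoc\<close>)
  qed (use assms(2-) in \<open>auto simp: R.l_distr R.r_distr\<close>)
qed

text \<open>A constant is supported at the empty word, which is neutral on both sides, so for a
  monomial only commutativity of coefficients is involved. Monomials are split off one at a
  time.\<close>

lemma alg_const_mult_commute:
  fixes p :: "'g list \<Rightarrow>\<^sub>0 'k::comm_ring_1"
  shows "alg_const c * p = p * alg_const c"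
proof (induction "card (Poly_Mapping.keys p)" arbitrary: p)
  case 0
  then show ?case by simp
next
  case (Suc m)
  then obtain v where v: "v \<in> Poly_Mapping.keys p"
    by (metis card_0_eq equals0I finite_keys nat.distinct(1))
  let ?s = "Poly_Mapping.single v (Poly_Mapping.lookup p v)"
  have "Poly_Mapping.keys (p - ?s) = Poly_Mapping.keys p - {v}"
    by (auto simp: in_keys_iff lookup_minus lookup_single when_def split: if_splits)
  then have "alg_const c * (p - ?s) = (p - ?s) * alg_const c"
    using Suc v by simp
  moreover have "alg_const c * ?s = ?s * alg_const c"
    by (simp add: alg_const_def mult_single mult.commute)
  ultimately have "alg_const c * (p - ?s + ?s) = (p - ?s + ?s) * alg_const c"
    by (simp only: distrib_left distrib_right)
  then show ?case by simp
qed

section \<open>The free algebra over a coefficient ring\<close>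

lemma free_algebra_simps [simp]:
  "monoid.mult (free_algebra K G) = (*)" "one (free_algebra K G) = 1"
  "ring.zero (free_algebra K G) = 0" "add (free_algebra K G) = (+)"
  by (simp_all add: free_algebra_def)

lemma free_algebra_smult: "c \<odot>\<^bsub>free_algebra K G\<^esub> p = alg_const c * p"
  by (simp add: free_algebra_def)

lemma free_algebra_carrier:
  "p \<in> carrier (free_algebra K G) \<longleftrightarrow>
     Poly_Mapping.keys p \<subseteq> lists G \<and> (\<forall>v. Poly_Mapping.lookup p v \<in> K)"
  by (simp add: free_algebra_def)

context coefficient_ring
begin

lemma single_closed:
  "v \<in> lists G \<Longrightarrow> c \<in> K \<Longrightarrow> Poly_Mapping.single v c \<in> carrier (free_algebra K G)"
  by (auto simp: free_algebra_carrier lookup_single when_def K_zero)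

lemma alg_gen_closed [simp]: "y \<in> G \<Longrightarrow> alg_gen y \<in> carrier (free_algebra K G)"
  by (simp add: alg_gen_def single_closed K_one)

lemma alg_const_closed [simp]: "c \<in> K \<Longrightarrow> alg_const c \<in> carrier (free_algebra K G)"
  by (simp add: alg_const_def zero_list_def single_closed)

lemma free_zero_closed [simp]: "0 \<in> carrier (free_algebra K G)"
  by (simp add: free_algebra_carrier K_zero)

lemma free_one_closed [simp]: "1 \<in> carrier (free_algebra K G)"
  using alg_const_closed[OF K_one] by (simp add: alg_const_def)

lemma free_add_closed [simp]:
  "p \<in> carrier (free_algebra K G) \<Longrightarrow> q \<in> carrier (free_algebra K G) \<Longrightarrow>
    p + q \<in> carrier (free_algebra K G)"
  using keys_add[of p q] unfolding free_algebra_carrier lookup_add by (blast intro: K_add)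

lemma free_uminus_closed [simp]:
  "p \<in> carrier (free_algebra K G) \<Longrightarrow> - p \<in> carrier (free_algebra K G)"
  by (auto simp: free_algebra_carrier K_uminus in_keys_iff)

lemma free_diff_closed [simp]:
  "p \<in> carrier (free_algebra K G) \<Longrightarrow> q \<in> carrier (free_algebra K G) \<Longrightarrow>
    p - q \<in> carrier (free_algebra K G)"
  unfolding diff_conv_add_uminus by (intro free_add_closed free_uminus_closed)

text \<open>Removing one monomial shrinks the support and stays inside the free algebra, so words
  over \<open>G\<close> and coefficients in \<open>K\<close> remain available at each step.\<close>

lemma free_algebra_induct [consumes 1, case_names zero add]:
  assumes "p \<in> carrier (free_algebra K G)" "P 0"
    and step: "\<And>v c p. v \<in> lists G \<Longrightarrow> c \<in> K \<Longrightarrow> p \<in> carrier (free_algebra K G) \<Longrightarrow> P p \<Longrightarrow>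
      P (Poly_Mapping.single v c + p)"
  shows "P p"
  using assms(1)
proof (induction "card (Poly_Mapping.keys p)" arbitrary: p)
  case 0
  then show ?case using assms(2) by simp
next
  case (Suc m)
  then obtain v where v: "v \<in> Poly_Mapping.keys p"
    by (metis card_0_eq equals0I finite_keys nat.distinct(1))
  let ?s = "Poly_Mapping.single v (Poly_Mapping.lookup p v)"
  have vG: "v \<in> lists G" "Poly_Mapping.lookup p v \<in> K"
    using v Suc.prems by (auto simp: free_algebra_carrier)
  have "Poly_Mapping.keys (p - ?s) = Poly_Mapping.keys p - {v}"
    by (auto simp: in_keys_iff lookup_minus lookup_single when_def split: if_splits)
  moreover have "p - ?s \<in> carrier (free_algebra K G)"
    using Suc.prems vG by (intro free_diff_closed single_closed)
  ultimately have "P (?s + (p - ?s))"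
    using Suc.hyps v vG by (intro step Suc.hyps(1)) auto
  then show ?case by simp
qed

lemma free_mult_closed [simp]:
  assumes p: "p \<in> carrier (free_algebra K G)" and q: "q \<in> carrier (free_algebra K G)"
  shows "p * q \<in> carrier (free_algebra K G)"
  using p
proof (induction p rule: free_algebra_induct)
  case (add v c p)
  have "Poly_Mapping.single v c * q \<in> carrier (free_algebra K G)"
    using q
  proof (induction q rule: free_algebra_induct)
    case (add v' c' q)
    then show ?case
      using \<open>v \<in> lists G\<close> \<open>c \<in> K\<close>
      by (auto simp: distrib_left mult_single plus_list_def intro!: free_add_closed single_closed K_mult)
  qed simp
  then show ?case
    using add by (simp add: distrib_right)
qed simp

lemma free_power_closed [simp]:
  "p \<in> carrier (free_algebra K G) \<Longrightarrow> p ^ k \<in> carrier (free_algebra K G)"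
  by (induction k) auto

lemma free_sum_closed [simp]:
  "(\<And>i. i \<in> A \<Longrightarrow> f i \<in> carrier (free_algebra K G)) \<Longrightarrow> sum f A \<in> carrier (free_algebra K G)"
  by (induction A rule: infinite_finite_induct) auto

lemma ring_free_algebra: "ring (free_algebra K G)"
proof (rule ringI)
  show "abelian_group (free_algebra K G)"
    by (rule abelian_groupI) (auto simp: algebra_simps intro!: bexI[of _ "- _"])
  show "Group.monoid (free_algebra K G)"
    by (rule monoidI) (auto simp: algebra_simps)
qed (auto simp: algebra_simps)

end

text \<open>Linearity is imposed through the constants alone, which suffices because a scalar acts
  on the free algebra as multiplication by its constant.\<close>

locale free_algebra_hom = scalar_algebra B K \<sigma>
  for B :: "('a, 'b) ring_scheme" (structure) and K :: "'k::comm_ring_1 set" and \<sigma> :: "'k \<Rightarrow> 'a" +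
  fixes G :: "'g set" and h :: "('g list \<Rightarrow>\<^sub>0 'k) \<Rightarrow> 'a"
  assumes hom: "h \<in> ring_hom (free_algebra K G) B"
    and hom_const: "c \<in> K \<Longrightarrow> h (alg_const c) = \<sigma> c"
begin

lemma hom_closed [simp]: "p \<in> carrier (free_algebra K G) \<Longrightarrow> h p \<in> carrier B"
  using hom by (rule ring_hom_closed)

lemma hom_mult [simp]: "p \<in> carrier (free_algebra K G) \<Longrightarrow> q \<in> carrier (free_algebra K G) \<Longrightarrow>
    h (p * q) = h p \<otimes> h q"
  using ring_hom_mult[OF hom] by simp

lemma hom_add [simp]: "p \<in> carrier (free_algebra K G) \<Longrightarrow> q \<in> carrier (free_algebra K G) \<Longrightarrow>
    h (p + q) = h p \<oplus> h q"
  using ring_hom_add[OF hom] by simp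

lemma hom_one [simp]: "h 1 = \<one>"
  using ring_hom_one[OF hom] by simp

lemma hom_zero [simp]: "h 0 = \<zero>"
  using ring_hom_zero[OF hom ring_free_algebra ring_axioms] by simp

lemma hom_diff_eq_zero_iff:
  assumes "p \<in> carrier (free_algebra K G)" "q \<in> carrier (free_algebra K G)"
  shows "h (p - q) = \<zero> \<longleftrightarrow> h p = h q"
proof -
  have "h p = h (p - q) \<oplus> h q"
    using assms by (simp flip: hom_add)
  then show ?thesis
    using assms by (metis a_comm add.r_cancel_one free_diff_closed hom_closed)
qed

lemma hom_power [simp]: "p \<in> carrier (free_algebra K G) \<Longrightarrow> h (p ^ k) = h p [^] k"
proof (induction k)
  case (Suc k)
  then have "h (p ^ k * p) = h p [^] k \<otimes> h p"
    by (subst hom_mult) auto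
  then show ?case
    by (simp add: power_commutes)
qed simp

lemma hom_sum [simp]: "finite A \<Longrightarrow> (\<And>i. i \<in> A \<Longrightarrow> f i \<in> carrier (free_algebra K G)) \<Longrightarrow>
    h (\<Sum>i\<in>A. f i) = (\<Oplus>i\<in>A. h (f i))"
  by (induction A rule: finite_induct) (auto simp: Pi_iff)

end

lemma free_algebra_hom_unique:
  assumes "free_algebra_hom B K \<sigma> G h" "free_algebra_hom B K \<sigma> G h'"
    and gens: "\<And>y. y \<in> G \<Longrightarrow> h (alg_gen y) = h' (alg_gen y)"
    and p: "p \<in> carrier (free_algebra K G)"
  shows "h p = h' p"
proof -
  interpret h: free_algebra_hom B K \<sigma> G h by fact
  interpret h': free_algebra_hom B K \<sigma> G h' by fact
  have single: "h (Poly_Mapping.single v c) = h' (Poly_Mapping.single v c)"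
    if "v \<in> lists G" "c \<in> K" for v c
    using that(1)
  proof (induction v)
    case Nil
    then show ?case
      using h.hom_const[OF that(2)] h'.hom_const[OF that(2)] by (simp add: alg_const_def zero_list_def)
  next
    case (Cons y v)
    have "Poly_Mapping.single (y # v) c = alg_gen y * Poly_Mapping.single v c"
      by (simp add: alg_gen_def mult_single plus_list_def)
    then show ?case
      using Cons that(2) by (simp add: gens h.single_closed)
  qed
  show ?thesis
    using p
  proof (induction p rule: h.free_algebra_induct)
    case (add v c p)
    then show ?case
      using single by (simp add: h.single_closed)
  qed simp
qed

section \<open>Evaluation of noncommutative polynomials\<close>

context scalar_algebra
begin

definition free_eval :: "('g \<Rightarrow> 'a) \<Rightarrow> ('g list \<Rightarrow>\<^sub>0 'k) \<Rightarrow> 'a" where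
  "free_eval f p = (\<Oplus>v\<in>Poly_Mapping.keys p.
     \<sigma> (Poly_Mapping.lookup p v) \<otimes> foldr (\<lambda>y b. f y \<otimes> b) v \<one>)"

lemma word_closed: "f \<in> G \<rightarrow> carrier B \<Longrightarrow> v \<in> lists G \<Longrightarrow> foldr (\<lambda>y b. f y \<otimes> b) v \<one> \<in> carrier B"
  by (induction v) auto

lemma word_append: "f \<in> G \<rightarrow> carrier B \<Longrightarrow> v \<in> lists G \<Longrightarrow> v' \<in> lists G \<Longrightarrow>
    foldr (\<lambda>y b. f y \<otimes> b) (v @ v') \<one> = foldr (\<lambda>y b. f y \<otimes> b) v \<one> \<otimes> foldr (\<lambda>y b. f y \<otimes> b) v' \<one>"
proof (induction v)
  case (Cons y v)
  have "f y \<in> carrier B" "foldr (\<lambda>y b. f y \<otimes> b) v \<one> \<in> carrier B" "foldr (\<lambda>y b. f y \<otimes> b) v' \<one> \<in> carrier B"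
    using Cons.prems by (auto intro: word_closed)
  then show ?case
    using Cons by (simp add: m_assoc)
qed (simp add: word_closed)

context
  fixes f :: "'g \<Rightarrow> 'a" and G :: "'g set"
  assumes f: "f \<in> G \<rightarrow> carrier B"
begin

text \<open>Words outside the support contribute zero. A common index set is what makes additivity
  accessible, since the support of a sum may shrink by cancellation.\<close>

lemma free_eval_superset:
  assumes "p \<in> carrier (free_algebra K G)" "finite S" "Poly_Mapping.keys p \<subseteq> S" "S \<subseteq> lists G"
  shows "free_eval f p = (\<Oplus>v\<in>S. \<sigma> (Poly_Mapping.lookup p v) \<otimes> foldr (\<lambda>y b. f y \<otimes> b) v \<one>)"
proof -
  have "foldr (\<lambda>y b. f y \<otimes> b) v \<one> \<in> carrier B" if "v \<in> S" for v
    using that assms(4) by (intro word_closed[OF f]) blast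
  then show ?thesis
    unfolding free_eval_def
    by (intro add.finprod_mono_neutral_cong_left)
      (use assms in \<open>auto simp: free_algebra_carrier in_keys_iff scalar_zero\<close>)
qed

lemma free_eval_closed:
  assumes "p \<in> carrier (free_algebra K G)"
  shows "free_eval f p \<in> carrier B"
proof -
  have "foldr (\<lambda>y b. f y \<otimes> b) v \<one> \<in> carrier B" if "v \<in> Poly_Mapping.keys p" for v
    using that assms by (intro word_closed[OF f]) (auto simp: free_algebra_carrier)
  then show ?thesis
    unfolding free_eval_def using assms by (intro finsum_closed) (auto simp: free_algebra_carrier)
qed

lemma free_eval_add:
  assumes "p \<in> carrier (free_algebra K G)" "q \<in> carrier (free_algebra K G)"
  shows "free_eval f (p + q) = free_eval f p \<oplus> free_eval f q"
proof -
  let ?S = "Poly_Mapping.keys p \<union> Poly_Mapping.keys q"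
  have S: "finite ?S" "?S \<subseteq> lists G" "Poly_Mapping.keys (p + q) \<subseteq> ?S"
    using assms keys_add[of p q] by (auto simp: free_algebra_carrier)
  have closed: "\<sigma> (Poly_Mapping.lookup p v) \<in> carrier B" "\<sigma> (Poly_Mapping.lookup q v) \<in> carrier B"
      "foldr (\<lambda>y b. f y \<otimes> b) v \<one> \<in> carrier B" if "v \<in> ?S" for v
    using that assms word_closed[OF f, of v] S(2) by (auto simp: free_algebra_carrier)
  have "free_eval f (p + q)
      = (\<Oplus>v\<in>?S. \<sigma> (Poly_Mapping.lookup p v) \<otimes> foldr (\<lambda>y b. f y \<otimes> b) v \<one>
               \<oplus> \<sigma> (Poly_Mapping.lookup q v) \<otimes> foldr (\<lambda>y b. f y \<otimes> b) v \<one>)"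
    unfolding free_eval_superset[OF free_add_closed[OF assms] S(1,3,2)]
    by (intro finsum_cong' refl)
      (use closed assms in \<open>auto simp: lookup_add free_algebra_carrier scalar_add l_distr\<close>)
  also have "\<dots> = free_eval f p \<oplus> free_eval f q"
    unfolding free_eval_superset[OF assms(1) S(1) Un_upper1 S(2)]
      free_eval_superset[OF assms(2) S(1) Un_upper2 S(2)]
    by (intro finsum_addf) (use closed in auto)
  finally show ?thesis .
qed

lemma free_eval_single:
  assumes "v \<in> lists G" "c \<in> K"
  shows "free_eval f (Poly_Mapping.single v c) = \<sigma> c \<otimes> foldr (\<lambda>y b. f y \<otimes> b) v \<one>"
  using free_eval_superset[OF single_closed[OF assms], of "{v}"] assms word_closed[OF f assms(1)]
  by (auto simp: keys_single finsum_singleton)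

text \<open>Distributivity reduces both factors to monomials. There the second coefficient has to
  move past the first word, which is where centrality of the scalars enters.\<close>

lemma free_eval_mult:
  assumes p: "p \<in> carrier (free_algebra K G)" and q: "q \<in> carrier (free_algebra K G)"
  shows "free_eval f (p * q) = free_eval f p \<otimes> free_eval f q"
  using p
proof (induction p rule: free_algebra_induct)
  case zero
  then show ?case
    using free_eval_closed[OF q] by (simp add: free_eval_def)
next
  case (add v c p)
  have vc: "v \<in> lists G" "c \<in> K" by fact+
  have "free_eval f (Poly_Mapping.single v c * q) = free_eval f (Poly_Mapping.single v c) \<otimes> free_eval f q"
    using q
  proof (induction q rule: free_algebra_induct)
    case zero
    then show ?case
      using free_eval_closed[OF single_closed[OF vc]] by (simp add: free_eval_def)
  next
    case (add v' c' q)
    let ?w = "\<lambda>v. foldr (\<lambda>y b. f y \<otimes> b) v \<one>"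
    have w: "?w v \<in> carrier B" "?w v' \<in> carrier B"
      using add vc word_closed[OF f] by auto
    have "\<sigma> (c * c') \<otimes> ?w (v @ v') = \<sigma> c \<otimes> (\<sigma> c' \<otimes> ?w v) \<otimes> ?w v'"
      using add vc w by (simp add: scalar_mult word_append[OF f] m_assoc del: foldr_append)
    also have "\<dots> = \<sigma> c \<otimes> ?w v \<otimes> (\<sigma> c' \<otimes> ?w v')"
      using add vc w by (subst scalar_central) (auto simp: m_assoc)
    finally have "free_eval f (Poly_Mapping.single v c * Poly_Mapping.single v' c')
        = free_eval f (Poly_Mapping.single v c) \<otimes> free_eval f (Poly_Mapping.single v' c')"
      using add vc by (simp add: mult_single plus_list_def free_eval_single K_mult)
    then show ?case
      using add vc by (simp add: distrib_left free_eval_add single_closed free_eval_closed r_distr)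
  qed
  then show ?case
    using add q by (simp add: distrib_right free_eval_add single_closed free_eval_closed l_distr)
qed

lemma free_eval_gen: "y \<in> G \<Longrightarrow> free_eval f (alg_gen y) = f y"
  using funcset_mem[OF f] free_eval_single[of "[y]" 1] by (simp add: alg_gen_def K_one scalar_one)

lemma free_eval_hom: "free_algebra_hom B K \<sigma> G (free_eval f)"
proof unfold_locales
  have const: "free_eval f (alg_const c) = \<sigma> c" if "c \<in> K" for c
    using that free_eval_single[of "[]" c] by (simp add: alg_const_def zero_list_def)
  then show "c \<in> K \<Longrightarrow> free_eval f (alg_const c) = \<sigma> c" for c .
  have "free_eval f 1 = \<one>"
    using const[OF K_one] by (simp add: alg_const_def scalar_one)
  then show "free_eval f \<in> ring_hom (free_algebra K G) B"
    by (intro ring_hom_memI) (simp_all add: free_eval_closed free_eval_mult free_eval_add)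
qed

end

end

section \<open>Quotients by relations and their universal property\<close>

locale presentation = coefficient_ring K
  for K :: "'k::comm_ring_1 set" +
  fixes G :: "'g set" and rels :: "('g list \<Rightarrow>\<^sub>0 'k) set"
  assumes rels_closed: "rels \<subseteq> carrier (free_algebra K G)"
begin

abbreviation F :: "('k, 'g list \<Rightarrow>\<^sub>0 'k) module" where
  "F \<equiv> free_algebra K G"

abbreviation A :: "('k, ('g list \<Rightarrow>\<^sub>0 'k) set) module" where
  "A \<equiv> presented_algebra K G rels"

definition relation_ideal :: "('g list \<Rightarrow>\<^sub>0 'k) set" where
  "relation_ideal = genideal F rels"

definition residue :: "('g list \<Rightarrow>\<^sub>0 'k) \<Rightarrow> ('g list \<Rightarrow>\<^sub>0 'k) set" where
  "residue p = relation_ideal +>\<^bsub>F\<^esub> p"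

sublocale F: ring F
  by (rule ring_free_algebra)

sublocale ideal: ideal relation_ideal F
  unfolding relation_ideal_def by (rule F.genideal_ideal[OF rels_closed])

lemma presented_algebra_simps:
  "carrier A = carrier (F Quot relation_ideal)"
  "monoid.mult A = monoid.mult (F Quot relation_ideal)"
  "one A = one (F Quot relation_ideal)"
  "ring.zero A = ring.zero (F Quot relation_ideal)"
  "add A = add (F Quot relation_ideal)"
  by (simp_all add: presented_algebra_def quotient_algebra_def relation_ideal_def)

sublocale A: ring A
  by (rule ring_cong[OF ideal.quotient_is_ring presented_algebra_simps])

lemma residue_hom: "residue \<in> ring_hom F A"
  using ideal.rcos_ring_hom unfolding ring_hom_def
  by (simp add: presented_algebra_simps residue_def[abs_def])

lemma carrier_cases:
  assumes "C \<in> carrier A"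
  obtains p where "p \<in> carrier F" "C = residue p"
  using assms by (auto simp: presented_algebra_simps FactRing_def A_RCOSETS_def' residue_def)

lemma residue_eq_iff:
  "p \<in> carrier F \<Longrightarrow> q \<in> carrier F \<Longrightarrow> residue p = residue q \<longleftrightarrow> p - q \<in> relation_ideal"
proof -
  assume p: "p \<in> carrier F" and q: "q \<in> carrier F"
  have "\<ominus>\<^bsub>F\<^esub> q = - q"
    using q by (intro F.minus_equality) auto
  then have "p \<ominus>\<^bsub>F\<^esub> q = p - q"
    by (simp add: a_minus_def)
  then show ?thesis
    using F.quotient_eq_iff_same_a_r_cos[OF ideal.is_ideal p q] by (simp add: residue_def)
qed

lemma residue_rel: "p \<in> rels \<Longrightarrow> residue p = \<zero>\<^bsub>A\<^esub>"
  using F.genideal_self[OF rels_closed] F.a_rcos_zero[OF ideal.is_ideal]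
  by (auto simp: residue_def presented_algebra_simps relation_ideal_def FactRing_def)

sublocale A: scalar_algebra A K "\<lambda>c. residue (alg_const c)"
proof (intro scalar_algebra.intro scalar_algebra_axioms.intro A.ring_axioms coefficient_ring_axioms)
  note hom = ring_hom_closed[OF residue_hom] ring_hom_add[OF residue_hom, symmetric]
    ring_hom_mult[OF residue_hom, symmetric]
  show "residue (alg_const c) \<in> carrier A" if "c \<in> K" for c
    using that by (simp add: hom)
  show "residue (alg_const 1) = \<one>\<^bsub>A\<^esub>"
    using ring_hom_one[OF residue_hom] by (simp add: alg_const_def)
  show "residue (alg_const (c + d)) = residue (alg_const c) \<oplus>\<^bsub>A\<^esub> residue (alg_const d)"
    if "c \<in> K" "d \<in> K" for c d
    using that by (simp add: hom) (simp add: alg_const_def single_add)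
  show "residue (alg_const (c * d)) = residue (alg_const c) \<otimes>\<^bsub>A\<^esub> residue (alg_const d)"
    if "c \<in> K" "d \<in> K" for c d
    using that by (simp add: hom) (simp add: alg_const_def mult_single)
  show "residue (alg_const c) \<otimes>\<^bsub>A\<^esub> x = x \<otimes>\<^bsub>A\<^esub> residue (alg_const c)"
    if "c \<in> K" and x: "x \<in> carrier A" for c x
    using x
  proof (rule carrier_cases)
    fix p assume "p \<in> carrier F" "x = residue p"
    then show ?thesis
      using that(1) by (simp add: hom alg_const_mult_commute)
  qed
qed

sublocale residue: free_algebra_hom A K "\<lambda>c. residue (alg_const c)" G residue
  by unfold_locales (simp_all add: residue_hom)

text \<open>The scalar multiple is a union over all representatives of the coset. The class of
  \<open>alg_const c * y\<close> depends only on the class of \<open>y\<close>, so all sets in this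
  union coincide.\<close>

lemma smult_eq:
  assumes c: "c \<in> K" and x: "x \<in> carrier A"
  shows "c \<odot>\<^bsub>A\<^esub> x = residue (alg_const c) \<otimes>\<^bsub>A\<^esub> x"
proof -
  obtain p where p: "p \<in> carrier F" "x = residue p"
    using x by (rule carrier_cases)
  have "residue (alg_const c * y) = residue (alg_const c * p)" if "y \<in> x" for y
  proof -
    have y: "y \<in> carrier F" "residue y = residue p"
      using that p F.a_r_coset_subset_G[OF ideal.a_subset p(1)]
        F.a_repr_independence[OF _ p(1) ideal.a_subgroup, of y]
      by (auto simp: residue_def)
    then show ?thesis
      using c p(1) by simp
  qed
  moreover have "p \<in> x"
    using p ideal.a_rcos_self[OF p(1)] by (simp add: residue_def)
  ultimately have "(\<Union>y\<in>x. residue (alg_const c * y)) = residue (alg_const c * p)"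
    by blast
  moreover have "c \<odot>\<^bsub>A\<^esub> x = (\<Union>y\<in>x. residue (alg_const c * y))"
    by (simp add: presented_algebra_def quotient_algebra_def relation_ideal_def residue_def
      free_algebra_smult)
  ultimately show ?thesis
    using c p by simp
qed

text \<open>The kernel of the evaluation is an ideal containing the relators, hence the ideal they
  generate. The map is defined through a chosen representative, and two representatives differ by an
  element of this kernel.\<close>

lemma universal_property:
  assumes "scalar_algebra B K \<sigma>" and f: "f \<in> G \<rightarrow> carrier B"
    and rels: "\<And>p. p \<in> rels \<Longrightarrow> scalar_algebra.free_eval B \<sigma> f p = \<zero>\<^bsub>B\<^esub>"
  obtains \<phi> where "\<phi> \<in> ring_hom A B" "\<And>y. y \<in> G \<Longrightarrow> \<phi> (residue (alg_gen y)) = f y"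
    "\<And>c. c \<in> K \<Longrightarrow> \<phi> (residue (alg_const c)) = \<sigma> c"
proof -
  interpret B: scalar_algebra B K \<sigma> by fact
  interpret h: free_algebra_hom B K \<sigma> G "B.free_eval f"
    by (rule B.free_eval_hom[OF f])
  have "ideal (a_kernel F B (B.free_eval f)) F"
    by (rule ring_hom_ring.kernel_is_ideal[OF ring_hom_ringI2[OF F.ring_axioms B.ring_axioms h.hom]])
  moreover have "rels \<subseteq> a_kernel F B (B.free_eval f)"
    using rels rels_closed by (auto simp: a_kernel_def')
  ultimately have "relation_ideal \<subseteq> a_kernel F B (B.free_eval f)"
    unfolding relation_ideal_def by (rule F.genideal_minimal)
  then have kernel: "B.free_eval f p = \<zero>\<^bsub>B\<^esub>" if "p \<in> relation_ideal" for p
    using that by (auto simp: a_kernel_def')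
  define \<phi> where "\<phi> C = B.free_eval f (SOME p. p \<in> carrier F \<and> residue p = C)" for C
  have \<phi>: "\<phi> (residue p) = B.free_eval f p" if p: "p \<in> carrier F" for p
  proof -
    let ?q = "SOME q. q \<in> carrier F \<and> residue q = residue p"
    have q: "?q \<in> carrier F \<and> residue ?q = residue p"
      by (rule someI[of _ p]) (use p in simp)
    then have "B.free_eval f (?q - p) = \<zero>\<^bsub>B\<^esub>"
      using p residue_eq_iff[of ?q p] by (intro kernel) blast
    then show ?thesis
      unfolding \<phi>_def using p q by (simp add: h.hom_diff_eq_zero_iff)
  qed
  show ?thesis
  proof (rule that[of \<phi>])
    show "\<phi> \<in> ring_hom A B"
    proof (rule ring_hom_memI)
      fix x y assume x: "x \<in> carrier A" and y: "y \<in> carrier A"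
      obtain p q where pq: "p \<in> carrier F" "q \<in> carrier F" "x = residue p" "y = residue q"
        using carrier_cases[OF x] carrier_cases[OF y] by metis
      show "\<phi> (x \<otimes>\<^bsub>A\<^esub> y) = \<phi> x \<otimes>\<^bsub>B\<^esub> \<phi> y"
        unfolding pq(3,4) using pq(1,2) by (simp add: \<phi> flip: residue.hom_mult)
      show "\<phi> (x \<oplus>\<^bsub>A\<^esub> y) = \<phi> x \<oplus>\<^bsub>B\<^esub> \<phi> y"
        unfolding pq(3,4) using pq(1,2) by (simp add: \<phi> flip: residue.hom_add)
    next
      fix x assume x: "x \<in> carrier A"
      then show "\<phi> x \<in> carrier B"
        by (rule carrier_cases) (simp add: \<phi>)
    next
      show "\<phi> \<one>\<^bsub>A\<^esub> = \<one>\<^bsub>B\<^esub>"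
        using \<phi>[OF free_one_closed] by simp
    qed
  qed (use f in \<open>simp_all add: \<phi> B.free_eval_gen h.hom_const\<close>)
qed

lemma hom_unique:
  assumes "scalar_algebra B K \<sigma>" "\<phi> \<in> ring_hom A B" "\<phi>' \<in> ring_hom A B"
    and "\<And>y. y \<in> G \<Longrightarrow> \<phi> (residue (alg_gen y)) = \<phi>' (residue (alg_gen y))"
    and "\<And>c. c \<in> K \<Longrightarrow> \<phi> (residue (alg_const c)) = \<sigma> c"
    and "\<And>c. c \<in> K \<Longrightarrow> \<phi>' (residue (alg_const c)) = \<sigma> c"
    and x: "x \<in> carrier A"
  shows "\<phi> x = \<phi>' x"
proof -
  interpret B: scalar_algebra B K \<sigma> by fact
  obtain p where p: "p \<in> carrier F" "x = residue p"
    using x by (rule carrier_cases)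
  have "free_algebra_hom B K \<sigma> G (\<phi> \<circ> residue)" "free_algebra_hom B K \<sigma> G (\<phi>' \<circ> residue)"
    using assms(5,6) ring_hom_trans[OF residue_hom] assms(2,3)
    by (auto intro!: free_algebra_hom.intro free_algebra_hom_axioms.intro B.scalar_algebra_axioms)
  then have "(\<phi> \<circ> residue) p = (\<phi>' \<circ> residue) p"
    by (rule free_algebra_hom_unique[OF _ _ _ p(1)]) (simp add: assms(4))
  then show ?thesis
    using p(2) by simp
qed

end


section \<open>The defining relations as identities in an arbitrary algebra\<close>

lemma coefficient_ring_generate_ring:
  "coefficient_ring (generate_ring ring_of_type_algebra S :: 'k::comm_ring_1 set)"
proof -
  interpret T: ring "ring_of_type_algebra :: 'k ring"
    by (rule ring_from_type_algebra)
  have [simp]: "\<ominus>\<^bsub>ring_of_type_algebra\<^esub> c = - c" for c :: 'k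
    by (rule T.minus_equality) (simp_all add: ring_of_type_algebra_def)
  note I = generate_ring.intros[where R = "ring_of_type_algebra :: 'k ring" and H = S]
  show ?thesis
  proof
    show "1 \<in> generate_ring ring_of_type_algebra S"
      using I(1) by (simp add: ring_of_type_algebra_def)
    show "- c \<in> generate_ring ring_of_type_algebra S"
      if "c \<in> generate_ring ring_of_type_algebra S" for c :: 'k
      using I(3)[OF that] by simp
    show "c + d \<in> generate_ring ring_of_type_algebra S" "c * d \<in> generate_ring ring_of_type_algebra S"
      if "c \<in> generate_ring ring_of_type_algebra S" "d \<in> generate_ring ring_of_type_algebra S" for c d :: 'k
      using I(4)[OF that] I(5)[OF that] by (simp_all add: ring_of_type_algebra_def)
  qed
qed

lemma coefficient_ring_ground_ring: "coefficient_ring (ground_ring r)"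
  unfolding ground_ring_def by (rule coefficient_ring_generate_ring)

lemma ground_ring_gens:
  "qvar \<in> ground_ring r" "inverse qvar \<in> ground_ring r" "scalar (1 / of_nat r) \<in> ground_ring r"
  unfolding ground_ring_def by (auto intro: generate_ring.incl)

lemma qvar_diff_in_ground_ring: "qvar - inverse qvar \<in> ground_ring r"
proof -
  interpret coefficient_ring "ground_ring r"
    by (rule coefficient_ring_ground_ring)
  show ?thesis
    unfolding diff_conv_add_uminus by (intro K_add K_uminus ground_ring_gens)
qed

lemma qvar_square: "qvar * qvar = 1 + (qvar - inverse qvar) * qvar"
proof -
  have "qvar \<noteq> 0"
    by (simp add: qvar_def)
  then show ?thesis
    by (simp add: algebra_simps)
qed

lemma scalar_inverse_of_nat:
  assumes "r \<ge> 1"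
  shows "scalar (1 / of_nat r) * of_nat r = 1"
proof -
  have "of_nat m = to_fract [:of_nat m :: complex:]" for m
    by (induction m) (simp_all flip: to_fract_add to_fract_1 add: one_pCons)
  then have "scalar (1 / of_nat r) * of_nat r = to_fract ([:1 / of_nat r:] * [:of_nat r :: complex:])"
    by (simp add: scalar_def del: mult_pCons_left mult_pCons_right)
  also have "\<dots> = 1"
    using assms by (simp flip: one_pCons)
  finally show ?thesis .
qed

lemma ball_setcompr: "(\<forall>x\<in>{f i |i. P i}. Q x) \<longleftrightarrow> (\<forall>i. P i \<longrightarrow> Q (f i))"
  "(\<forall>x\<in>{f' i j |i j. P' i j}. Q x) \<longleftrightarrow> (\<forall>i j. P' i j \<longrightarrow> Q (f' i j))"
  by auto

lemma affine_indices_succ: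
  "i \<in> affine_indices n \<Longrightarrow> (i + 1) mod int n \<in> affine_indices n"
  "i \<in> affine_indices n \<Longrightarrow> (i - 1) mod int n \<in> affine_indices n"
  by (auto simp: affine_indices_iff)

lemma hecke_gens_iff [simp]:
  "HS i \<in> hecke_gens n \<longleftrightarrow> i \<in> affine_indices n" "HRho \<in> hecke_gens n" "HRhoInv \<in> hecke_gens n"
  by (auto simp: hecke_gens_def)

lemma yokonuma_gens_iff [simp]:
  "YT j \<in> yokonuma_gens n \<longleftrightarrow> 1 \<le> j \<and> j \<le> n" "YG i \<in> yokonuma_gens n \<longleftrightarrow> 1 \<le> i \<and> i < n"
  "YX \<in> yokonuma_gens n" "YXInv \<in> yokonuma_gens n"
  by (auto simp: yokonuma_gens_def)

lemma hecke_rels_closed: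
  assumes "coefficient_ring K" "qvar - inverse qvar \<in> K"
  shows "hecke_rels n \<subseteq> carrier (free_algebra K (hecke_gens n))"
proof -
  interpret coefficient_ring K by fact
  show ?thesis
    using assms(2) unfolding hecke_rels_def by (auto simp: affine_indices_succ)
qed

lemma transpose_Suc_bounds:
  "Suc 0 \<le> i \<Longrightarrow> i < n \<Longrightarrow> Suc 0 \<le> j \<Longrightarrow> j \<le> n \<Longrightarrow> Suc 0 \<le> Transposition.transpose i (Suc i) j"
  "Suc 0 \<le> i \<Longrightarrow> i < n \<Longrightarrow> Suc 0 \<le> j \<Longrightarrow> j \<le> n \<Longrightarrow> Transposition.transpose i (Suc i) j \<le> n"
  by (auto simp: Transposition.transpose_def)

lemma ye_closed:
  assumes "coefficient_ring K" "scalar (1 / of_nat r) \<in> K" "1 \<le> i" "i < n"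
  shows "ye r i \<in> carrier (free_algebra K (yokonuma_gens n))"
proof -
  interpret coefficient_ring K by fact
  show ?thesis
    unfolding ye_def using assms(2-) by (intro free_mult_closed free_sum_closed) auto
qed

lemma yokonuma_rels_closed:
  assumes "coefficient_ring K" "scalar (1 / of_nat r) \<in> K" "qvar - inverse qvar \<in> K"
  shows "yokonuma_rels r n \<subseteq> carrier (free_algebra K (yokonuma_gens n))"
proof -
  interpret coefficient_ring K by fact
  show ?thesis
    using assms(3) ye_closed[OF assms(1,2)] unfolding yokonuma_rels_def
    by (auto intro!: free_diff_closed free_mult_closed alg_gen_closed intro: transpose_Suc_bounds)
qed

text \<open>Both directions matter: applied to residue classes it makes H a representation of its
  own relations, and applied to an evaluation it supplies the hypothesis of
  \<open>universal_property\<close>.\<close>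

lemma hecke_rels_iff:
  assumes "free_algebra_hom B K \<sigma> (hecke_gens n) h" and z: "qvar - inverse qvar \<in> K"
    and gens: "\<And>i. i \<in> affine_indices n \<Longrightarrow> h (hs i) = s i" "h hrho = w" "h hrho_inv = w'"
  shows "(\<forall>p\<in>hecke_rels n. h p = \<zero>\<^bsub>B\<^esub>) \<longleftrightarrow>
    affine_hecke_rep B K \<sigma> (qvar - inverse qvar) n s w w'"
proof -
  interpret h: free_algebra_hom B K \<sigma> "hecke_gens n" h by fact
  have closed: "s i \<in> carrier B" if "i \<in> affine_indices n" for i
    using h.hom_closed[of "hs i"] that by (simp flip: gens)
  have closed_w: "w \<in> carrier B" "w' \<in> carrier B"
    by (simp_all flip: gens)
  let ?z = "qvar - inverse qvar"
  note simps = gens h.hom_const affine_indices_succ closed closed_w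
  show ?thesis
  proof
    assume rels: "\<forall>p\<in>hecke_rels n. h p = \<zero>\<^bsub>B\<^esub>"
    have rel: "h p = h q" if "p - q \<in> hecke_rels n"
      "p \<in> carrier (free_algebra K (hecke_gens n))" "q \<in> carrier (free_algebra K (hecke_gens n))" for p q
      using rels that h.hom_diff_eq_zero_iff by blast
    show "affine_hecke_rep B K \<sigma> ?z n s w w'"
    proof (intro affine_hecke_rep.intro affine_hecke_rep_axioms.intro h.scalar_algebra_axioms z closed closed_w)
      show "w \<otimes>\<^bsub>B\<^esub> w' = \<one>\<^bsub>B\<^esub>" "w' \<otimes>\<^bsub>B\<^esub> w = \<one>\<^bsub>B\<^esub>"
        using rel[of "hrho * hrho_inv" 1] rel[of "hrho_inv * hrho" 1] by (simp_all add: hecke_rels_def simps)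
    next
      fix i assume i: "i \<in> affine_indices n"
      then have "hrho * hs i - hs ((i - 1) mod int n) * hrho \<in> hecke_rels n"
        unfolding hecke_rels_def by blast
      from rel[OF this] show "w \<otimes>\<^bsub>B\<^esub> s i = s ((i - 1) mod int n) \<otimes>\<^bsub>B\<^esub> w"
        using i by (simp add: simps)
    next
      fix i j assume ij: "i \<in> affine_indices n" "j \<in> affine_indices n"
        "\<not> [i - j = 1] (mod int n)" "\<not> [i - j = -1] (mod int n)"
      then have "hs i * hs j - hs j * hs i \<in> hecke_rels n"
        unfolding hecke_rels_def by blast
      from rel[OF this] show "s i \<otimes>\<^bsub>B\<^esub> s j = s j \<otimes>\<^bsub>B\<^esub> s i"
        using ij(1,2) by (simp add: simps)
    next
      fix i assume i: "i \<in> affine_indices n" and n: "3 \<le> n"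
      then have "hs i * hs ((i + 1) mod int n) * hs i
          - hs ((i + 1) mod int n) * hs i * hs ((i + 1) mod int n) \<in> hecke_rels n"
        unfolding hecke_rels_def by blast
      from rel[OF this] show "s i \<otimes>\<^bsub>B\<^esub> s ((i + 1) mod int n) \<otimes>\<^bsub>B\<^esub> s i
          = s ((i + 1) mod int n) \<otimes>\<^bsub>B\<^esub> s i \<otimes>\<^bsub>B\<^esub> s ((i + 1) mod int n)"
        using i by (simp add: simps)
    next
      fix i assume i: "i \<in> affine_indices n"
      then have "hs i ^ 2 - (1 + alg_const ?z * hs i) \<in> hecke_rels n"
        unfolding hecke_rels_def by blast
      from rel[OF this] show "s i \<otimes>\<^bsub>B\<^esub> s i = \<one>\<^bsub>B\<^esub> \<oplus>\<^bsub>B\<^esub> \<sigma> ?z \<otimes>\<^bsub>B\<^esub> s i"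
        using i z by (simp add: simps power2_eq_square)
    qed
  next
    assume "affine_hecke_rep B K \<sigma> ?z n s w w'"
    then interpret affine_hecke_rep B K \<sigma> ?z n s w w' .
    show "\<forall>p\<in>hecke_rels n. h p = \<zero>\<^bsub>B\<^esub>"
      unfolding hecke_rels_def ball_Un ball_setcompr power2_eq_square
    proof (intro conjI allI impI; (elim conjE)?)
      fix i j assume "i \<in> affine_indices n" "j \<in> affine_indices n"
        "\<not> [i - j = 1] (mod int n)" "\<not> [i - j = -1] (mod int n)"
      then show "h (hs i * hs j - hs j * hs i) = \<zero>\<^bsub>B\<^esub>"
        using s_comm[of i j] by (simp add: h.hom_diff_eq_zero_iff simps)
    qed (auto simp: h.hom_diff_eq_zero_iff simps w_inverse w_s s_braid s_square)
  qed
qed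

lemma yokonuma_rels_iff:
  assumes "free_algebra_hom B K \<sigma> (yokonuma_gens n) h" and z: "qvar - inverse qvar \<in> K"
    and a: "scalar (1 / of_nat r) \<in> K" and r: "r \<ge> 1"
    and gens: "\<And>j. 1 \<le> j \<Longrightarrow> j \<le> n \<Longrightarrow> h (yt j) = t j" "\<And>i. 1 \<le> i \<Longrightarrow> i < n \<Longrightarrow> h (yg i) = g i"
      "h yX = x" "h yX_inv = x'"
  shows "(\<forall>p\<in>yokonuma_rels r n. h p = \<zero>\<^bsub>B\<^esub>) \<longleftrightarrow>
    yokonuma_rep B K \<sigma> (qvar - inverse qvar) (scalar (1 / of_nat r)) r n t g x x'"
proof -
  interpret h: free_algebra_hom B K \<sigma> "yokonuma_gens n" h by fact
  have closed: "t j \<in> carrier B" if "1 \<le> j" "j \<le> n" for j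
    using h.hom_closed[of "yt j"] that by (simp flip: gens)
  have closed': "g i \<in> carrier B" if "1 \<le> i" "i < n" for i
    using h.hom_closed[of "yg i"] that by (simp flip: gens)
  have closed_x: "x \<in> carrier B" "x' \<in> carrier B"
    by (simp_all flip: gens)
  have ye: "h (ye r i) = \<sigma> (scalar (1 / of_nat r)) \<otimes>\<^bsub>B\<^esub>
      (\<Oplus>\<^bsub>B\<^esub>s\<in>{..<r}. t i [^]\<^bsub>B\<^esub> s \<otimes>\<^bsub>B\<^esub> t (Suc i) [^]\<^bsub>B\<^esub> (r - s))"
    if i: "1 \<le> i" "i < n" for i
  proof -
    have "h (\<Sum>s<r. yt i ^ s * yt (i + 1) ^ (r - s)) = (\<Oplus>\<^bsub>B\<^esub>s\<in>{..<r}. h (yt i ^ s * yt (i + 1) ^ (r - s)))"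
      using i by (intro h.hom_sum) auto
    also have "\<dots> = (\<Oplus>\<^bsub>B\<^esub>s\<in>{..<r}. t i [^]\<^bsub>B\<^esub> s \<otimes>\<^bsub>B\<^esub> t (Suc i) [^]\<^bsub>B\<^esub> (r - s))"
      using i by (intro h.finsum_cong') (auto simp: gens closed)
    finally show ?thesis
      unfolding ye_def using a i by (subst h.hom_mult) (auto intro!: h.free_sum_closed simp: h.hom_const)
  qed
  have ye_closed: "ye r i \<in> carrier (free_algebra K (yokonuma_gens n))" if "1 \<le> i" "i < n" for i
    using ye_closed[OF h.coefficient_ring_axioms a that] .
  let ?z = "qvar - inverse qvar" and ?a = "scalar (1 / of_nat r)"
  note simps = gens h.hom_const closed closed' closed_x ye ye_closed
  show ?thesis
  proof
    assume rels: "\<forall>p\<in>yokonuma_rels r n. h p = \<zero>\<^bsub>B\<^esub>"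
    have rel: "h p = h q" if "p - q \<in> yokonuma_rels r n"
      "p \<in> carrier (free_algebra K (yokonuma_gens n))" "q \<in> carrier (free_algebra K (yokonuma_gens n))" for p q
      using rels that h.hom_diff_eq_zero_iff by blast
    show "yokonuma_rep B K \<sigma> ?z ?a r n t g x x'"
    proof (intro yokonuma_rep.intro yokonuma_rep_axioms.intro h.scalar_algebra_axioms z a closed_x
        scalar_inverse_of_nat[OF r])
      show "x \<otimes>\<^bsub>B\<^esub> x' = \<one>\<^bsub>B\<^esub>" "x' \<otimes>\<^bsub>B\<^esub> x = \<one>\<^bsub>B\<^esub>"
        using rel[of "yX * yX_inv" 1] rel[of "yX_inv * yX" 1] by (simp_all add: yokonuma_rels_def simps)
      show "t j \<in> carrier B" if "j \<in> {1..n}" for j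
        using that closed by simp
      show "g i \<in> carrier B" if "i \<in> {1..<n}" for i
        using that closed' by simp
    next
      fix i j assume ij: "i \<in> {1..<n}" "j \<in> {1..<n}" "\<bar>int i - int j\<bar> \<ge> 2"
      then have "yg i * yg j - yg j * yg i \<in> yokonuma_rels r n"
        unfolding yokonuma_rels_def by blast
      from rel[OF this] show "g i \<otimes>\<^bsub>B\<^esub> g j = g j \<otimes>\<^bsub>B\<^esub> g i"
        using ij(1,2) by (simp add: simps)
    next
      fix i assume i: "1 \<le> i" "i + 1 < n"
      then have "yg i * yg (i + 1) * yg i - yg (i + 1) * yg i * yg (i + 1) \<in> yokonuma_rels r n"
        unfolding yokonuma_rels_def by blast
      from rel[OF this] show "g i \<otimes>\<^bsub>B\<^esub> g (i + 1) \<otimes>\<^bsub>B\<^esub> g i = g (i + 1) \<otimes>\<^bsub>B\<^esub> g i \<otimes>\<^bsub>B\<^esub> g (i + 1)"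
        using i by (simp add: simps)
    next
      fix i j assume ij: "i \<in> {1..n}" "j \<in> {1..n}"
      then have "yt i * yt j - yt j * yt i \<in> yokonuma_rels r n"
        unfolding yokonuma_rels_def by blast
      from rel[OF this] show "t i \<otimes>\<^bsub>B\<^esub> t j = t j \<otimes>\<^bsub>B\<^esub> t i"
        using ij by (simp add: simps)
    next
      fix i j assume ij: "i \<in> {1..<n}" "j \<in> {1..n}"
      then have "yg i * yt j - yt (Transposition.transpose i (i + 1) j) * yg i \<in> yokonuma_rels r n"
        unfolding yokonuma_rels_def by blast
      from rel[OF this] show "g i \<otimes>\<^bsub>B\<^esub> t j = t (Transposition.transpose i (i + 1) j) \<otimes>\<^bsub>B\<^esub> g i"
        using ij transpose_Suc_bounds[of i n j] by (simp add: simps)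
    next
      fix j assume j: "j \<in> {1..n}"
      then have "yt j ^ r - 1 \<in> yokonuma_rels r n"
        unfolding yokonuma_rels_def by blast
      from rel[OF this] show "t j [^]\<^bsub>B\<^esub> r = \<one>\<^bsub>B\<^esub>"
        using j by (simp add: simps)
    next
      fix i assume i: "i \<in> {1..<n}"
      then have "yg i ^ 2 - (1 + alg_const ?z * ye r i * yg i) \<in> yokonuma_rels r n"
        unfolding yokonuma_rels_def by blast
      from rel[OF this] show "g i \<otimes>\<^bsub>B\<^esub> g i = \<one>\<^bsub>B\<^esub> \<oplus>\<^bsub>B\<^esub> \<sigma> ?z \<otimes>\<^bsub>B\<^esub>
          (\<sigma> ?a \<otimes>\<^bsub>B\<^esub> (\<Oplus>\<^bsub>B\<^esub>s\<in>{..<r}. t i [^]\<^bsub>B\<^esub> s \<otimes>\<^bsub>B\<^esub> t (i + 1) [^]\<^bsub>B\<^esub> (r - s))) \<otimes>\<^bsub>B\<^esub> g i"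
        using i z by (simp add: simps power2_eq_square)
    next
      assume n: "1 < n"
      then have "yg 1 * yX * yg 1 * yX - yX * yg 1 * yX * yg 1 \<in> yokonuma_rels r n"
        unfolding yokonuma_rels_def by simp
      from rel[OF this] show "g 1 \<otimes>\<^bsub>B\<^esub> x \<otimes>\<^bsub>B\<^esub> g 1 \<otimes>\<^bsub>B\<^esub> x = x \<otimes>\<^bsub>B\<^esub> g 1 \<otimes>\<^bsub>B\<^esub> x \<otimes>\<^bsub>B\<^esub> g 1"
        using n by (simp add: simps)
    next
      fix i assume i: "2 \<le> i" "i < n"
      then have "yg i * yX - yX * yg i \<in> yokonuma_rels r n"
        unfolding yokonuma_rels_def by blast
      from rel[OF this] show "g i \<otimes>\<^bsub>B\<^esub> x = x \<otimes>\<^bsub>B\<^esub> g i"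
        using i by (simp add: simps)
    next
      fix j assume j: "j \<in> {1..n}"
      then have "yt j * yX - yX * yt j \<in> yokonuma_rels r n"
        unfolding yokonuma_rels_def by blast
      from rel[OF this] show "t j \<otimes>\<^bsub>B\<^esub> x = x \<otimes>\<^bsub>B\<^esub> t j"
        using j by (simp add: simps)
    qed
  next
    assume "yokonuma_rep B K \<sigma> ?z ?a r n t g x x'"
    then interpret yokonuma_rep B K \<sigma> ?z ?a r n t g x x' .
    show "\<forall>p\<in>yokonuma_rels r n. h p = \<zero>\<^bsub>B\<^esub>"
      unfolding yokonuma_rels_def ball_Un ball_setcompr power2_eq_square
    proof (intro conjI allI impI; (elim conjE)?)
      fix i j assume "i \<in> {1..n}" "j \<in> {1..n}"
      then show "h (yt i * yt j - yt j * yt i) = \<zero>\<^bsub>B\<^esub>"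
        using t_comm[of i j] by (simp add: h.hom_diff_eq_zero_iff simps)
    next
      fix i j assume "i \<in> {1..<n}" "j \<in> {1..<n}" "\<bar>int i - int j\<bar> \<ge> 2"
      then show "h (yg i * yg j - yg j * yg i) = \<zero>\<^bsub>B\<^esub>"
        using g_comm[of i j] by (simp add: h.hom_diff_eq_zero_iff simps)
    next
      fix i j assume "i \<in> {1..<n}" "j \<in> {1..n}"
      then show "h (yg i * yt j - yt (Transposition.transpose i (i + 1) j) * yg i) = \<zero>\<^bsub>B\<^esub>"
        using g_t[of i j] transpose_Suc_bounds[of i n j] by (simp add: h.hom_diff_eq_zero_iff simps)
    next
      fix i assume "1 \<le> i" "i + 1 < n"
      then show "h (yg i * yg (i + 1) * yg i - yg (i + 1) * yg i * yg (i + 1)) = \<zero>\<^bsub>B\<^esub>"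
        using g_braid[of i] by (simp add: h.hom_diff_eq_zero_iff simps)
    next
      fix i assume "i \<in> {1..<n}"
      then show "h (yg i * yg i - (1 + alg_const ?z * ye r i * yg i)) = \<zero>\<^bsub>B\<^esub>"
        using g_square[of i] z by (simp add: h.hom_diff_eq_zero_iff simps)
    next
      fix i assume "2 \<le> i" "i < n"
      then show "h (yg i * yX - yX * yg i) = \<zero>\<^bsub>B\<^esub>"
        using x_g[of i] by (simp add: h.hom_diff_eq_zero_iff simps)
    next
      fix j assume "j \<in> {1..n}"
      then show "h (yt j * yX - yX * yt j) = \<zero>\<^bsub>B\<^esub>"
        using t_x[of j] by (simp add: h.hom_diff_eq_zero_iff simps)
    next
      fix j assume "j \<in> {1..n}"
      then show "h (yt j ^ r - 1) = \<zero>\<^bsub>B\<^esub>"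
        using t_power[of j] by (simp add: h.hom_diff_eq_zero_iff simps)
    next
      show "\<forall>p\<in>{yX * yX_inv - 1, yX_inv * yX - 1}. h p = \<zero>\<^bsub>B\<^esub>"
        by (simp add: h.hom_diff_eq_zero_iff simps x_inverse)
    next
      show "\<forall>p\<in>if 1 < n then {yg 1 * yX * yg 1 * yX - yX * yg 1 * yX * yg 1} else {}. h p = \<zero>\<^bsub>B\<^esub>"
        using x_g1 by (simp add: h.hom_diff_eq_zero_iff simps)
    qed
  qed
qed


section \<open>The embedding\<close>

text \<open>The units of the two corners add up to 1, and mixed products vanish because
  \<open>e (1 - e)\<close> can be inserted between their factors.\<close>

lemma (in ring) hom_plus_complement:
  assumes e: "e \<in> carrier R" "e \<otimes> e = e"
    and \<alpha>: "\<alpha> \<in> ring_hom A (corner R e)" and \<beta>: "\<beta> \<in> ring_hom A (corner R (\<one> \<ominus> e))"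
  shows "(\<lambda>x. \<alpha> x \<oplus> \<beta> x) \<in> ring_hom A R"
proof (rule ring_hom_memI)
  let ?f = "\<one> \<ominus> e"
  have ef: "e \<otimes> ?f = \<zero>" "?f \<otimes> e = \<zero>" "e \<oplus> ?f = \<one>"
    using e by (simp_all add: minus_eq r_distr l_distr r_minus l_minus r_neg) algebra
  have closed: "\<alpha> x \<in> carrier R" "\<beta> x \<in> carrier R"
      "e \<otimes> \<alpha> x = \<alpha> x" "\<alpha> x \<otimes> e = \<alpha> x" "?f \<otimes> \<beta> x = \<beta> x" "\<beta> x \<otimes> ?f = \<beta> x"
    if "x \<in> carrier A" for x
    using ring_hom_closed[OF \<alpha> that] ring_hom_closed[OF \<beta> that] by simp_all
  show "\<alpha> \<one>\<^bsub>A\<^esub> \<oplus> \<beta> \<one>\<^bsub>A\<^esub> = \<one>"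
    using ring_hom_one[OF \<alpha>] ring_hom_one[OF \<beta>] ef by simp
  show "\<alpha> x \<oplus> \<beta> x \<in> carrier R" if "x \<in> carrier A" for x
    using closed[OF that] by simp
  fix x y assume x: "x \<in> carrier A" and y: "y \<in> carrier A"
  have "\<alpha> x \<otimes> \<beta> y = \<alpha> x \<otimes> (e \<otimes> ?f) \<otimes> \<beta> y"
    using closed[OF x] closed[OF y] e by (metis m_assoc minus_closed one_closed)
  moreover have "\<beta> x \<otimes> \<alpha> y = \<beta> x \<otimes> (?f \<otimes> e) \<otimes> \<alpha> y"
    using closed[OF x] closed[OF y] e by (metis m_assoc minus_closed one_closed)
  ultimately have orth: "\<alpha> x \<otimes> \<beta> y = \<zero>" "\<beta> x \<otimes> \<alpha> y = \<zero>"
    using closed[OF x] closed[OF y] by (simp_all add: ef)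
  show "\<alpha> (x \<otimes>\<^bsub>A\<^esub> y) \<oplus> \<beta> (x \<otimes>\<^bsub>A\<^esub> y) = (\<alpha> x \<oplus> \<beta> x) \<otimes> (\<alpha> y \<oplus> \<beta> y)"
    using closed[OF x] closed[OF y] ring_hom_mult[OF \<alpha> x y] ring_hom_mult[OF \<beta> x y]
    by (simp add: l_distr r_distr orth)
  show "\<alpha> (x \<oplus>\<^bsub>A\<^esub> y) \<oplus> \<beta> (x \<oplus>\<^bsub>A\<^esub> y) = (\<alpha> x \<oplus> \<beta> x) \<oplus> (\<alpha> y \<oplus> \<beta> y)"
    using closed[OF x] closed[OF y] ring_hom_add[OF \<alpha> x y] ring_hom_add[OF \<beta> x y]
    by (simp add: a_ac)
qed

lemma (in ring) complement_idem:
  assumes "e \<in> carrier R" "e \<otimes> e = e"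
  shows "(\<one> \<ominus> e) \<otimes> (\<one> \<ominus> e) = \<one> \<ominus> e"
  using assms by (simp add: minus_eq r_distr l_distr r_minus l_minus r_neg)

lemma hecke_algebra_hom:
  assumes K: "coefficient_ring K" "qvar - inverse qvar \<in> K"
    and rep: "affine_hecke_rep B K \<sigma> (qvar - inverse qvar) n s w w'"
  defines "res \<equiv> presentation.residue K (hecke_gens n) (hecke_rels n)"
  shows "\<exists>\<phi> \<in> ring_hom (presented_algebra K (hecke_gens n) (hecke_rels n)) B.
    (\<forall>i\<in>affine_indices n. \<phi> (res (hs i)) = s i) \<and> \<phi> (res hrho) = w \<and> \<phi> (res hrho_inv) = w' \<and>
    (\<forall>c\<in>K. \<phi> (res (alg_const c)) = \<sigma> c)"
proof -
  interpret rep: affine_hecke_rep B K \<sigma> "qvar - inverse qvar" n s w w' by fact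
  interpret H: presentation K "hecke_gens n" "hecke_rels n"
    using K by (intro presentation.intro presentation_axioms.intro hecke_rels_closed)
  define f where "f = case_hecke_gen s w w'"
  have f_simps: "f (HS i) = s i" "f HRho = w" "f HRhoInv = w'" for i
    by (simp_all add: f_def)
  have f: "f \<in> hecke_gens n \<rightarrow> carrier B"
    by (auto simp: f_def split: hecke_gen.splits)
  have "\<forall>p\<in>hecke_rels n. rep.free_eval f p = \<zero>\<^bsub>B\<^esub>"
    using rep by (subst hecke_rels_iff[OF rep.free_eval_hom[OF f] K(2)])
      (auto simp: rep.free_eval_gen[OF f] f_simps)
  then obtain \<phi> where \<phi>: "\<phi> \<in> ring_hom H.A B"
      "\<And>y. y \<in> hecke_gens n \<Longrightarrow> \<phi> (H.residue (alg_gen y)) = f y"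
      "\<And>c. c \<in> K \<Longrightarrow> \<phi> (H.residue (alg_const c)) = \<sigma> c"
    using H.universal_property[OF rep.scalar_algebra_axioms f] by metis
  show ?thesis
    using \<phi>(1) by (rule bexI[rotated]) (simp add: \<phi>(2,3) res_def f_simps)
qed

lemma yokonuma_algebra_hom:
  assumes K: "coefficient_ring K" "qvar - inverse qvar \<in> K" "scalar (1 / of_nat r) \<in> K" and r: "r \<ge> 1"
    and rep: "yokonuma_rep B K \<sigma> (qvar - inverse qvar) (scalar (1 / of_nat r)) r n t g x x'"
  defines "res \<equiv> presentation.residue K (yokonuma_gens n) (yokonuma_rels r n)"
  shows "\<exists>\<phi> \<in> ring_hom (presented_algebra K (yokonuma_gens n) (yokonuma_rels r n)) B.
    (\<forall>j\<in>{1..n}. \<phi> (res (yt j)) = t j) \<and> (\<forall>i\<in>{1..<n}. \<phi> (res (yg i)) = g i) \<and>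
    \<phi> (res yX) = x \<and> \<phi> (res yX_inv) = x' \<and> (\<forall>c\<in>K. \<phi> (res (alg_const c)) = \<sigma> c)"
proof -
  interpret rep: yokonuma_rep B K \<sigma> "qvar - inverse qvar" "scalar (1 / of_nat r)" r n t g x x' by fact
  interpret Y: presentation K "yokonuma_gens n" "yokonuma_rels r n"
    using K by (intro presentation.intro presentation_axioms.intro yokonuma_rels_closed)
  define f where "f = case_yokonuma_gen t g x x'"
  have f_simps: "f (YT j) = t j" "f (YG i) = g i" "f YX = x" "f YXInv = x'" for i j
    by (simp_all add: f_def)
  have f: "f \<in> yokonuma_gens n \<rightarrow> carrier B"
    by (auto simp: f_def split: yokonuma_gen.splits)
  have "\<forall>p\<in>yokonuma_rels r n. rep.free_eval f p = \<zero>\<^bsub>B\<^esub>"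
    using rep by (subst yokonuma_rels_iff[OF rep.free_eval_hom[OF f] K(2,3) r])
      (auto simp: rep.free_eval_gen[OF f] f_simps)
  then obtain \<phi> where \<phi>: "\<phi> \<in> ring_hom Y.A B"
      "\<And>y. y \<in> yokonuma_gens n \<Longrightarrow> \<phi> (Y.residue (alg_gen y)) = f y"
      "\<And>c. c \<in> K \<Longrightarrow> \<phi> (Y.residue (alg_const c)) = \<sigma> c"
    using Y.universal_property[OF rep.scalar_algebra_axioms f] by metis
  show ?thesis
    using \<phi>(1) by (rule bexI[rotated]) (simp add: \<phi>(2,3) res_def f_simps)
qed

text \<open>Each average is sent to the average of \<open>r\<close> copies of 1, which is 1.\<close>

lemma (in yokonuma_rep) hom_unit_idem:
  assumes B': "scalar_algebra B' K \<sigma>'" and \<psi>: "\<psi> \<in> ring_hom B B'"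
    and const: "\<And>c. c \<in> K \<Longrightarrow> \<psi> (\<sigma> c) = \<sigma>' c"
    and t: "\<And>j. j \<in> {1..n} \<Longrightarrow> \<psi> (t j) = \<one>\<^bsub>B'\<^esub>"
  shows "\<psi> unit_idem = \<one>\<^bsub>B'\<^esub>"
proof -
  interpret B': scalar_algebra B' K \<sigma>' by fact
  interpret \<psi>: ring_hom_ring B B' \<psi>
    by (rule ring_hom_ringI2[OF ring_axioms B'.ring_axioms \<psi>])
  have avg: "\<psi> (average j) = \<one>\<^bsub>B'\<^esub>" if j: "j \<in> {1..n}" for j
  proof -
    have pow: "\<psi> (t j [^] (s::nat)) = \<one>\<^bsub>B'\<^esub>" for s
      using j t by (induction s) simp_all
    have "\<psi> (\<Oplus>s\<in>{..<r}. t j [^] s) = (\<Oplus>\<^bsub>B'\<^esub>s\<in>{..<r}. \<psi> (t j [^] s))"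
      using j by (subst \<psi>.hom_finsum) (auto simp: comp_def)
    then show ?thesis
      using j B'.average_const[OF a_in_K a_inverse B'.one_closed]
      by (simp add: average_def const pow)
  qed
  have "k \<le> n \<Longrightarrow> \<psi> (descending_prod B average k) = \<one>\<^bsub>B'\<^esub>" for k
    by (induction k) (auto simp: avg)
  then show ?thesis
    by (simp add: unit_idem_def)
qed

theorem corollary3p11:
  fixes r n :: nat
  assumes "r \<ge> 1" and "n \<ge> 1"
  shows "\<exists>\<phi> \<in> algebra_hom (ground_ring r)
            (extended_affine_hecke_algebra r n) (affine_yokonuma_hecke_algebra r n).
          inj_on \<phi> (carrier (extended_affine_hecke_algebra r n))"
proof -
  define K where "K = ground_ring r"
  define z where "z = qvar - inverse qvar"
  have K: "coefficient_ring K" "z \<in> K" "scalar (1 / of_nat r) \<in> K" "qvar \<in> K"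
    by (simp_all add: K_def z_def coefficient_ring_ground_ring qvar_diff_in_ground_ring ground_ring_gens)
  interpret H: presentation K "hecke_gens n" "hecke_rels n"
    using K unfolding z_def by (intro presentation.intro presentation_axioms.intro hecke_rels_closed)
  interpret Y: presentation K "yokonuma_gens n" "yokonuma_rels r n"
    using K unfolding z_def by (intro presentation.intro presentation_axioms.intro yokonuma_rels_closed)
  define \<sigma>H where "\<sigma>H = (\<lambda>c. H.residue (alg_const c))"
  define \<sigma>Y where "\<sigma>Y = (\<lambda>c. Y.residue (alg_const c))"
  \<comment> \<open>Relators have residue zero, so the classes of the generators of H satisfy the
    Hecke relations; the same argument follows for Y.\<close>
  interpret AH: affine_hecke_rep H.A K \<sigma>H z n "\<lambda>i. H.residue (hs i)" "H.residue hrho" "H.residue hrho_inv"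
    unfolding z_def \<sigma>H_def using K(2) H.residue_rel
    by (subst hecke_rels_iff[OF H.residue.free_algebra_hom_axioms, symmetric]) (auto simp: z_def)
  interpret AY: yokonuma_rep Y.A K \<sigma>Y z "scalar (1 / of_nat r)" r n "\<lambda>j. Y.residue (yt j)"
    "\<lambda>i. Y.residue (yg i)" "Y.residue yX" "Y.residue yX_inv"
    unfolding z_def \<sigma>Y_def using K(2,3) assms(1) Y.residue_rel
    by (subst yokonuma_rels_iff[OF Y.residue.free_algebra_hom_axioms, symmetric]) (auto simp: z_def)
  define e where "e = AY.unit_idem"
  have e: "e \<in> carrier Y.A" "e \<otimes>\<^bsub>Y.A\<^esub> e = e"
    by (simp_all add: e_def AY.unit_idem_idem)
  let ?f = "\<one>\<^bsub>Y.A\<^esub> \<ominus>\<^bsub>Y.A\<^esub> e"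
  have f: "?f \<in> carrier Y.A" "?f \<otimes>\<^bsub>Y.A\<^esub> ?f = ?f"
    using e by (simp_all add: Y.A.complement_idem)
  interpret C: bernstein_hecke_rep "corner Y.A e" K "\<lambda>c. \<sigma>Y c \<otimes>\<^bsub>Y.A\<^esub> e" z n
    "\<lambda>i. Y.residue (yg i) \<otimes>\<^bsub>Y.A\<^esub> e" "Y.residue yX \<otimes>\<^bsub>Y.A\<^esub> e" "Y.residue yX_inv \<otimes>\<^bsub>Y.A\<^esub> e"
    unfolding e_def by (rule AY.bernstein_hecke_rep_corner)
  interpret F: scalar_algebra "corner Y.A ?f" K "\<lambda>c. \<sigma>Y c \<otimes>\<^bsub>Y.A\<^esub> ?f"
    using f by (rule AY.scalar_algebra_corner)

  obtain \<alpha> where \<alpha>: "\<alpha> \<in> ring_hom H.A (corner Y.A e)"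
      "\<forall>i\<in>affine_indices n. \<alpha> (H.residue (hs i)) = C.affine_gen i"
      "\<alpha> (H.residue hrho) = C.rho"
      and \<alpha>_const: "\<forall>c\<in>K. \<alpha> (\<sigma>H c) = \<sigma>Y c \<otimes>\<^bsub>Y.A\<^esub> e"
    using hecke_algebra_hom[OF K(1) K(2)[unfolded z_def] C.affine_hecke_rep[unfolded z_def]]
    unfolding \<sigma>H_def z_def by blast
  \<comment> \<open>From here on, only unitality for the corner of 1 - e, the homomorphism property
    and the values on constants of this map matter.\<close>
  obtain \<epsilon> where \<epsilon>: "\<epsilon> \<in> ring_hom H.A (corner Y.A ?f)"
      and \<epsilon>_const: "\<forall>c\<in>K. \<epsilon> (\<sigma>H c) = \<sigma>Y c \<otimes>\<^bsub>Y.A\<^esub> ?f"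
    using hecke_algebra_hom[where n = n, OF K(1) K(2)[unfolded z_def]
        F.trivial_affine_hecke_rep[OF K(2)[unfolded z_def] K(4) qvar_square]]
    unfolding \<sigma>H_def by blast
  define v where "v = AH.braid.V (n - 1)"
  have v: "v \<in> Units H.A" "v \<in> carrier H.A"
    using AH.V_Units by (auto simp: v_def H.A.Units_closed)
  interpret BH: bernstein_hecke_rep H.A K \<sigma>H z n "\<lambda>i. H.residue (hs (int i))"
    "inv\<^bsub>H.A\<^esub> v \<otimes>\<^bsub>H.A\<^esub> H.residue hrho" "H.residue hrho_inv \<otimes>\<^bsub>H.A\<^esub> v"
    unfolding v_def by (rule AH.bernstein_hecke_rep)
  obtain \<psi> where \<psi>: "\<psi> \<in> ring_hom Y.A H.A"
      "\<forall>j\<in>{1..n}. \<psi> (Y.residue (yt j)) = \<one>\<^bsub>H.A\<^esub>"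
      "\<forall>i\<in>{1..<n}. \<psi> (Y.residue (yg i)) = H.residue (hs (int i))"
      "\<psi> (Y.residue yX) = inv\<^bsub>H.A\<^esub> v \<otimes>\<^bsub>H.A\<^esub> H.residue hrho"
      "\<forall>c\<in>K. \<psi> (\<sigma>Y c) = \<sigma>H c"
    using yokonuma_algebra_hom[OF K(1) K(2)[unfolded z_def] K(3) assms(1)
        BH.yokonuma_rep[OF K(3) scalar_inverse_of_nat[OF assms(1)], unfolded z_def]]
    unfolding \<sigma>Y_def by blast
  interpret \<psi>: ring_hom_ring Y.A H.A \<psi>
    by (rule ring_hom_ringI2[OF Y.A.ring_axioms H.A.ring_axioms \<psi>(1)])
  have \<psi>e: "\<psi> e = \<one>\<^bsub>H.A\<^esub>"
    unfolding e_def by (rule AY.hom_unit_idem[OF AH.scalar_algebra_axioms \<psi>(1)]) (use \<psi>(2,5) in auto)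
  \<comment> \<open>The unit of the corner is e, so the restriction of \<psi> is unital precisely
    because \<psi>(e) = 1.\<close>
  have \<psi>_corner: "\<psi> \<in> ring_hom (corner Y.A e) H.A"
    by (rule ring_hom_memI) (simp_all add: \<psi>e)
  then have \<psi>\<alpha>: "\<psi> \<circ> \<alpha> \<in> ring_hom H.A H.A"
    using \<alpha>(1) by (rule ring_hom_trans[rotated])
  interpret \<psi>\<alpha>: ring_hom_ring H.A H.A "\<psi> \<circ> \<alpha>"
    by (rule ring_hom_ringI2[OF H.A.ring_axioms H.A.ring_axioms \<psi>\<alpha>])
  have \<psi>_V: "\<psi> (descending_prod (corner Y.A e) (\<lambda>i. Y.residue (yg i) \<otimes>\<^bsub>Y.A\<^esub> e) k)
      = descending_prod H.A (\<lambda>i. H.residue (hs (int i))) k" if "k < n" for k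
    using that
  proof (induction k)
    case (Suc k)
    have "descending_prod (corner Y.A e) (\<lambda>i. Y.residue (yg i) \<otimes>\<^bsub>Y.A\<^esub> e) k \<in> carrier (corner Y.A e)"
      using Suc.prems by (intro C.braid.V_closed) auto
    then show ?case
      using Suc e AY.g_closed[of "Suc k"] AH.braid.g_closed[of "Suc k"] by (simp add: \<psi>(3) \<psi>e del: AY.g_closed)
  qed (simp add: \<psi>e)
  have \<psi>\<alpha>_rho: "\<psi> (\<alpha> (H.residue hrho)) = H.residue hrho"
  proof -
    have "C.braid.V (n - 1) \<in> carrier (corner Y.A e)"
      using assms(2) by (intro C.braid.V_closed) auto
    \<comment> \<open>The image of X_1 was chosen with the inverse of \<open>v\<close> in front so
      that it cancels against the image of V.\<close>
    then have "\<psi> C.rho = v \<otimes>\<^bsub>H.A\<^esub> (inv\<^bsub>H.A\<^esub> v \<otimes>\<^bsub>H.A\<^esub> H.residue hrho)"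
      using assms(2) e v unfolding C.rho_def by (simp add: \<psi>_V \<psi>(4) \<psi>e v_def)
    then show ?thesis
      using v by (simp add: \<alpha>(3) flip: H.A.m_assoc)
  qed
  have \<psi>\<alpha>_pos: "\<psi> (\<alpha> (H.residue (hs i))) = H.residue (hs i)" if "1 \<le> i" "i < int n" for i
  proof -
    define k where "k = nat i"
    have k: "i = int k" "1 \<le> k" "k < n"
      using that by (auto simp: k_def)
    have "Y.residue (yg k) \<in> carrier Y.A" "H.residue (hs i) \<in> carrier H.A"
      using k by (auto simp: affine_indices_iff intro!: AY.g_closed)
    then show ?thesis
      using e k by (simp add: \<alpha>(2) affine_indices_iff C.affine_gen_def \<psi>(3) \<psi>e)
  qed
  have w: "H.residue hrho \<in> Units H.A"
    by (rule H.A.UnitsI[OF AH.w_closed AH.w_inverse])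
  have \<psi>\<alpha>_id: "\<psi> (\<alpha> x) = x" if x: "x \<in> carrier H.A" for x
  proof -
    have "(\<psi> \<circ> \<alpha>) x = id x"
    proof (rule H.hom_unique[OF AH.scalar_algebra_axioms \<psi>\<alpha> _ _ _ _ x])
      show "id \<in> ring_hom H.A H.A"
        by (rule ring_hom_memI) simp_all
      show "(\<psi> \<circ> \<alpha>) (H.residue (alg_const c)) = \<sigma>H c" if "c \<in> K" for c
      proof -
        have "\<alpha> (H.residue (alg_const c)) = \<sigma>Y c \<otimes>\<^bsub>Y.A\<^esub> e"
          using \<alpha>_const that by (simp add: \<sigma>H_def)
        then show ?thesis
          using that e \<psi>(5) by (simp add: \<psi>e)
      qed
      show "id (H.residue (alg_const c)) = \<sigma>H c" if "c \<in> K" for c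
        by (simp add: \<sigma>H_def)
      fix y assume y: "y \<in> hecke_gens n"
      show "(\<psi> \<circ> \<alpha>) (H.residue (alg_gen y)) = id (H.residue (alg_gen y))"
      proof (cases y)
        case (HS i)
        show ?thesis
        proof (cases "i = 0")
          case True
          then have n: "2 \<le> n" "0 \<in> affine_indices n" "1 \<in> affine_indices n"
            using y HS by (auto simp: affine_indices_iff)
          \<comment> \<open>\<psi> is prescribed only on positive indices. The composite fixes h_rho
            and the generator of index 1, so applying it to this relation and cancelling h_rho
            determines its value at index 0.\<close>
          have shift: "H.residue hrho \<otimes>\<^bsub>H.A\<^esub> H.residue (hs 1) = H.residue (hs 0) \<otimes>\<^bsub>H.A\<^esub> H.residue hrho"
            using AH.w_s[OF n(3)] by simp
          have "H.residue hrho \<otimes>\<^bsub>H.A\<^esub> H.residue (hs 1)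
              = (\<psi> \<circ> \<alpha>) (H.residue hrho \<otimes>\<^bsub>H.A\<^esub> H.residue (hs 1))"
            using n AH.s_closed[OF n(3)] by (subst \<psi>\<alpha>.hom_mult) (auto simp: \<psi>\<alpha>_rho \<psi>\<alpha>_pos)
          also have "\<dots> = (\<psi> \<circ> \<alpha>) (H.residue (hs 0)) \<otimes>\<^bsub>H.A\<^esub> H.residue hrho"
            unfolding shift using AH.s_closed[OF n(2)] by (subst \<psi>\<alpha>.hom_mult) (auto simp: \<psi>\<alpha>_rho)
          finally have "(\<psi> \<circ> \<alpha>) (H.residue (hs 0)) = H.residue (hs 0)"
            unfolding shift
            by (intro H.A.Units_r_cancel[OF w _ AH.s_closed[OF n(2)]] \<psi>\<alpha>.hom_closed AH.s_closed[OF n(2)])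
              (rule sym)
          then show ?thesis
            using HS True by simp
        next
          case False
          then show ?thesis
            using HS y \<psi>\<alpha>_pos[of i] by (simp add: affine_indices_iff)
        qed
      next
        case HRho
        then show ?thesis
          using \<psi>\<alpha>_rho by simp
      next
        case HRhoInv
        have "(\<psi> \<circ> \<alpha>) (H.residue hrho_inv) \<otimes>\<^bsub>H.A\<^esub> H.residue hrho
            = (\<psi> \<circ> \<alpha>) (H.residue hrho_inv \<otimes>\<^bsub>H.A\<^esub> H.residue hrho)"
          by (subst \<psi>\<alpha>.hom_mult) (auto simp: \<psi>\<alpha>_rho)
        also have "\<dots> = H.residue hrho_inv \<otimes>\<^bsub>H.A\<^esub> H.residue hrho"
          unfolding AH.w_inverse by (rule \<psi>\<alpha>.hom_one)
        finally have "(\<psi> \<circ> \<alpha>) (H.residue hrho_inv) = H.residue hrho_inv"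
          by (intro H.A.Units_r_cancel[OF w _ AH.w_closed(2)] \<psi>\<alpha>.hom_closed AH.w_closed(2))
        then show ?thesis
          using HRhoInv by simp
      qed
    qed
    then show ?thesis by simp
  qed

  define \<phi> where "\<phi> x = \<alpha> x \<oplus>\<^bsub>Y.A\<^esub> \<epsilon> x" for x
  have \<phi>_hom: "\<phi> \<in> ring_hom H.A Y.A"
    unfolding \<phi>_def[abs_def] by (rule Y.A.hom_plus_complement[OF e \<alpha>(1) \<epsilon>])
  have \<phi>_const: "\<phi> (\<sigma>H c) = \<sigma>Y c" if "c \<in> K" for c
  proof -
    have "\<phi> (\<sigma>H c) = \<sigma>Y c \<otimes>\<^bsub>Y.A\<^esub> (e \<oplus>\<^bsub>Y.A\<^esub> ?f)"
      using that e f by (simp add: \<phi>_def \<alpha>_const \<epsilon>_const Y.A.r_distr)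
    also have "e \<oplus>\<^bsub>Y.A\<^esub> ?f = \<one>\<^bsub>Y.A\<^esub>"
      using e Y.A.a_lcomm[of e "\<one>\<^bsub>Y.A\<^esub>" "\<ominus>\<^bsub>Y.A\<^esub> e"] by (simp add: Y.A.minus_eq Y.A.r_neg)
    finally show ?thesis
      using that by simp
  qed
  have "\<phi> (c \<odot>\<^bsub>H.A\<^esub> x) = c \<odot>\<^bsub>Y.A\<^esub> \<phi> x" if "c \<in> K" "x \<in> carrier H.A" for c x
    using that \<phi>_const[OF that(1)] AH.scalar_closed[OF that(1)] ring_hom_closed[OF \<phi>_hom that(2)]
    by (simp add: H.smult_eq Y.smult_eq ring_hom_mult[OF \<phi>_hom] flip: \<sigma>H_def \<sigma>Y_def)
      (simp add: \<sigma>H_def \<sigma>Y_def ring_hom_mult[OF \<phi>_hom])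
  with \<phi>_hom have \<phi>: "\<phi> \<in> algebra_hom K H.A Y.A"
    by (simp add: algebra_hom_def)
  have \<psi>\<phi>: "\<psi> (\<phi> x) = x" if x: "x \<in> carrier H.A" for x
  proof -
    have closed: "\<alpha> x \<in> carrier Y.A" "\<epsilon> x \<in> carrier Y.A" "?f \<otimes>\<^bsub>Y.A\<^esub> \<epsilon> x = \<epsilon> x"
      using ring_hom_closed[OF \<alpha>(1) x] ring_hom_closed[OF \<epsilon> x] by simp_all
    \<comment> \<open>\<psi> kills 1 - e and hence all values of \<epsilon>, so on the sum of
      \<alpha> and \<epsilon> it sees \<alpha> alone.\<close>
    have "\<psi> ?f = \<zero>\<^bsub>H.A\<^esub>"
      using e by (simp add: Y.A.minus_eq \<psi>e H.A.r_neg)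
    then have "\<psi> (\<epsilon> x) = \<zero>\<^bsub>H.A\<^esub>"
      using \<psi>.hom_mult[OF f(1) closed(2)] closed by simp
    then show ?thesis
      using closed \<psi>\<alpha>_id[OF x] x by (simp add: \<phi>_def)
  qed
  have "inj_on \<phi> (carrier H.A)"
    by (rule inj_on_inverseI[where g = \<psi>, OF \<psi>\<phi>])
  with \<phi> show ?thesis
    unfolding K_def extended_affine_hecke_algebra_def affine_yokonuma_hecke_algebra_def by blast
qed

end
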